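(* Let $n\ge2$, let $f\in\mathbb{R}[X_1,\ldots,X_n]$ be a symmetric polynomial of degree $4$, and let $\Omega$ be the set of $2$-partitions of $n$. Then $f$ is non-negative (on $\mathbb{R}^n$) if and only if for all $\omega\in\Omega$ the polynomial $f^\omega$ is a sum of squares of polynomials.
   Context: Symmetric means invariant under all permutations of the variables. A $2$-partition of $n$ is a pair $\omega=(\omega_1,\omega_2)$ of positive integers with $\omega_1\ge\omega_2$ and $\omega_1+\omega_2=n$. For such $\omega$, $f^\omega\in\mathbb{R}[T_1,T_2]$ is the polynomial $f^\omega:=f(T_1,\ldots,T_1,T_2,\ldots,T_2)$ where $T_1$ is substituted for $\omega_1$ of the variables and $T_2$ for the remaining $\omega_2$ variables. *)

theory Defs
  imports Complex_Main "HOL-Library.Poly_Mapping" "HOL-Combinatorics.Permutations"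
begin

text \<open>
  Real polynomials in the variables indexed by the natural numbers: a monomial is the finitely
  supported function giving the exponent of each variable, a polynomial is the finitely supported
  function giving the coefficient of each monomial. The ring structure is the convolution one of
  \<^theory>\<open>HOL-Library.Poly_Mapping\<close>.
\<close>

type_synonym real_mpoly = "(nat \<Rightarrow>\<^sub>0 nat) \<Rightarrow>\<^sub>0 real"

definition Const :: "real \<Rightarrow> real_mpoly" where
  "Const c = Poly_Mapping.single 0 c"

definition Var :: "nat \<Rightarrow> real_mpoly" where
  "Var i = Poly_Mapping.single (Poly_Mapping.single i 1) 1"

text \<open>The ring of polynomials in the variables with indices \<open>1, \<dots>, n\<close>, as a subset of the type.\<close>

definition polys :: "nat \<Rightarrow> real_mpoly set" where
  "polys n = {f. \<forall>m \<in> Poly_Mapping.keys f. Poly_Mapping.keys m \<subseteq> {1..n}}"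

definition monom_degree :: "(nat \<Rightarrow>\<^sub>0 nat) \<Rightarrow> nat" where
  "monom_degree m = (\<Sum>i \<in> Poly_Mapping.keys m. Poly_Mapping.lookup m i)"

text \<open>The total degree; by convention it is \<open>0\<close> for the zero polynomial.\<close>

definition total_degree :: "real_mpoly \<Rightarrow> nat" where
  "total_degree f = Max (insert 0 (monom_degree ` Poly_Mapping.keys f))"

definition poly_eval :: "(nat \<Rightarrow> real) \<Rightarrow> real_mpoly \<Rightarrow> real" where
  "poly_eval x f = (\<Sum>m \<in> Poly_Mapping.keys f.
     Poly_Mapping.lookup f m * (\<Prod>i \<in> Poly_Mapping.keys m. x i ^ Poly_Mapping.lookup m i))"

text \<open>Simultaneous substitution of the polynomial \<open>\<sigma> i\<close> for the variable with index \<open>i\<close>.\<close>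

definition poly_subst :: "(nat \<Rightarrow> real_mpoly) \<Rightarrow> real_mpoly \<Rightarrow> real_mpoly" where
  "poly_subst \<sigma> f = (\<Sum>m \<in> Poly_Mapping.keys f.
     Const (Poly_Mapping.lookup f m) *
     (\<Prod>i \<in> Poly_Mapping.keys m. \<sigma> i ^ Poly_Mapping.lookup m i))"

definition symmetric_poly :: "nat \<Rightarrow> real_mpoly \<Rightarrow> bool" where
  "symmetric_poly n f \<longleftrightarrow> (\<forall>\<pi>. \<pi> permutes {1..n} \<longrightarrow> poly_subst (\<lambda>i. Var (\<pi> i)) f = f)"

text \<open>
  A point of \<open>n\<close>-dimensional real space is given by the values \<open>x 1, \<dots>, x n\<close> of a function;
  for \<open>f \<in> polys n\<close> the other values of \<open>x\<close> do not enter \<open>poly_eval x f\<close>.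
\<close>

definition nonneg_poly :: "real_mpoly \<Rightarrow> bool" where
  "nonneg_poly f \<longleftrightarrow> (\<forall>x. 0 \<le> poly_eval x f)"

definition two_partitions :: "nat \<Rightarrow> (nat \<times> nat) set" where
  "two_partitions n = {(\<omega>1, \<omega>2). 0 < \<omega>2 \<and> \<omega>2 \<le> \<omega>1 \<and> \<omega>1 + \<omega>2 = n}"

text \<open>
  The variables \<open>T\<^sub>1\<close> and \<open>T\<^sub>2\<close> are \<open>Var 1\<close> and \<open>Var 2\<close>. For \<open>f \<in> polys n\<close> and a 2-partition
  \<open>\<omega>\<close> of \<open>n\<close>, the variables replaced by \<open>T\<^sub>2\<close> are the last \<open>snd \<omega>\<close> ones.
\<close>

definition partition_poly :: "nat \<times> nat \<Rightarrow> real_mpoly \<Rightarrow> real_mpoly" where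
  "partition_poly \<omega> f = poly_subst (\<lambda>i. if i \<le> fst \<omega> then Var 1 else Var 2) f"

definition sum_of_squares :: "nat \<Rightarrow> real_mpoly \<Rightarrow> bool" where
  "sum_of_squares k p \<longleftrightarrow>
     (\<exists>(r::nat) g. (\<forall>j<r. g j \<in> polys k) \<and> p = (\<Sum>j<r. (g j)\<^sup>2))"

end

theory Submission
  imports Defs "HOL-Analysis.Analysis" "HOL-Computational_Algebra.Fundamental_Theorem_Algebra"
begin

text \<open>
  If \<open>f \<ge> 0\<close>, then the homogenisation of \<open>f\<^sup>\<omega>\<close> is a non-negative ternary quartic form, hence a sum of
  squares by Hilbert's theorem. For the latter, subtract the largest multiple of \<open>(x\<^sup>2 + y\<^sup>2 + z\<^sup>2)\<^sup>2\<close>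
  that keeps the form non-negative and rotate the resulting zero to \<open>(1, 0, 0)\<close>. The form becomes
  \<open>f\<^sub>2 x\<^sup>2 + 2 f\<^sub>3 x + f\<^sub>4\<close> with univariate \<open>f\<^sub>i\<close> after setting \<open>z = 1\<close>, where \<open>f\<^sub>2 f\<^sub>4 - f\<^sub>3\<^sup>2\<close> is
  non-negative and so a sum \<open>u\<^sup>2 + v\<^sup>2\<close>. In the main case \<open>f\<^sub>2 = l\<^sup>2 + m\<^sup>2\<close> has a non-real root \<open>z\<close>, and a
  combination \<open>w = \<alpha> u + \<beta> v\<close> with \<open>\<alpha>\<^sup>2 + \<beta>\<^sup>2 \<le> 1\<close> satisfies \<open>w(z) = i f\<^sub>3(z)\<close>; then
  \<open>h\<^sub>1 = (l f\<^sub>3 - m w) / f\<^sub>2\<close> and \<open>h\<^sub>2 = (m f\<^sub>3 + l w) / f\<^sub>2\<close> are polynomials and the form equals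
  \<open>(l x + h\<^sub>1)\<^sup>2 + (m x + h\<^sub>2)\<^sup>2\<close> plus a non-negative univariate polynomial.

  Conversely, on the points with prescribed first two power sums \<open>f\<close> attains its minimum at a point
  with at most two distinct coordinates, and there the value of \<open>f\<close> is a value of some \<open>f\<^sup>\<omega>\<close>.
\<close>

section \<open>Evaluation of polynomials\<close>

lemma monom_eval_superset:
  fixes x :: "nat \<Rightarrow> 'a::comm_semiring_1"
  assumes "finite A" "Poly_Mapping.keys m \<subseteq> A"
  shows "(\<Prod>i\<in>Poly_Mapping.keys m. x i ^ Poly_Mapping.lookup m i)
       = (\<Prod>i\<in>A. x i ^ Poly_Mapping.lookup m i)"
  by (rule prod.mono_neutral_left) (use assms in \<open>auto simp: in_keys_iff\<close>)

lemma monom_eval_add: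
  fixes x :: "nat \<Rightarrow> 'a::comm_semiring_1"
  shows "(\<Prod>i\<in>Poly_Mapping.keys (m + m'). x i ^ Poly_Mapping.lookup (m + m') i)
    = (\<Prod>i\<in>Poly_Mapping.keys m. x i ^ Poly_Mapping.lookup m i)
      * (\<Prod>i\<in>Poly_Mapping.keys m'. x i ^ Poly_Mapping.lookup m' i)"
proof -
  let ?A = "Poly_Mapping.keys m \<union> Poly_Mapping.keys m'"
  have "finite ?A" by simp
  note s = monom_eval_superset[OF this]
  show ?thesis
    unfolding s[OF keys_add] s[OF Un_upper1] s[OF Un_upper2]
    by (simp add: lookup_add power_add prod.distrib)
qed

lemma poly_eval_superset:
  assumes "finite A" "Poly_Mapping.keys f \<subseteq> A"
  shows "poly_eval x f = (\<Sum>m\<in>A. Poly_Mapping.lookup f m *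
     (\<Prod>i \<in> Poly_Mapping.keys m. x i ^ Poly_Mapping.lookup m i))"
  unfolding poly_eval_def
  by (rule sum.mono_neutral_left) (use assms in \<open>auto simp: in_keys_iff\<close>)

lemma poly_eval_add: "poly_eval x (f + g) = poly_eval x f + poly_eval x g"
proof -
  let ?A = "Poly_Mapping.keys f \<union> Poly_Mapping.keys g"
  have "finite ?A" by simp
  note s = poly_eval_superset[OF this, of _ x]
  show ?thesis
    unfolding s[OF keys_add] s[OF Un_upper1] s[OF Un_upper2]
    by (simp add: lookup_add distrib_right sum.distrib)
qed

lemma poly_eval_zero: "poly_eval x 0 = 0"
  by (simp add: poly_eval_def)

lemma poly_eval_sum: "poly_eval x (\<Sum>i\<in>I. f i) = (\<Sum>i\<in>I. poly_eval x (f i))"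
  by (induction I rule: infinite_finite_induct) (auto simp: poly_eval_add poly_eval_zero)

lemma poly_eval_single:
  "poly_eval x (Poly_Mapping.single m c) =
     c * (\<Prod>i\<in>Poly_Mapping.keys m. x i ^ Poly_Mapping.lookup m i)"
  by (simp add: poly_eval_superset[of "{m}"])

lemma sum_single_lookup:
  "(\<Sum>m\<in>Poly_Mapping.keys f. Poly_Mapping.single m (Poly_Mapping.lookup f m)) = f"
  by (rule poly_mapping_eqI) (auto simp: lookup_sum lookup_single when_def in_keys_iff)

lemma poly_eval_mult: "poly_eval x (f * g) = poly_eval x f * poly_eval x g"
proof -
  let ?s = "\<lambda>f m. Poly_Mapping.single m (Poly_Mapping.lookup f m)"
  have "f * g = (\<Sum>m\<in>Poly_Mapping.keys f. ?s f m) * (\<Sum>m\<in>Poly_Mapping.keys g. ?s g m)"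
    by (simp add: sum_single_lookup)
  also have "\<dots> = (\<Sum>m\<in>Poly_Mapping.keys f. \<Sum>m'\<in>Poly_Mapping.keys g. ?s f m * ?s g m')"
    by (simp add: sum_product)
  finally have "poly_eval x (f * g) =
      (\<Sum>m\<in>Poly_Mapping.keys f. \<Sum>m'\<in>Poly_Mapping.keys g. poly_eval x (?s f m * ?s g m'))"
    by (simp add: poly_eval_sum)
  also have "\<dots> = poly_eval x f * poly_eval x g"
    unfolding mult_single poly_eval_single monom_eval_add
    unfolding poly_eval_def by (simp add: sum_product mult_ac)
  finally show ?thesis .
qed

lemma poly_eval_Const: "poly_eval x (Const c) = c"
  by (simp add: Const_def poly_eval_single)

lemma poly_eval_Var: "poly_eval x (Var i) = x i"
  by (simp add: Var_def poly_eval_single)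

lemma poly_eval_one: "poly_eval x 1 = 1"
  using poly_eval_Const[of x 1] by (simp add: Const_def)

lemma poly_eval_power: "poly_eval x (f ^ k) = poly_eval x f ^ k"
  by (induction k) (auto simp: poly_eval_one poly_eval_mult)

lemma poly_eval_prod: "poly_eval x (\<Prod>i\<in>I. f i) = (\<Prod>i\<in>I. poly_eval x (f i))"
  by (induction I rule: infinite_finite_induct) (auto simp: poly_eval_mult poly_eval_one)

lemma poly_eval_subst: "poly_eval x (poly_subst \<sigma> f) = poly_eval (\<lambda>i. poly_eval x (\<sigma> i)) f"
  unfolding poly_subst_def poly_eval_def[of "\<lambda>i. poly_eval x (\<sigma> i)"]
  by (simp add: poly_eval_sum poly_eval_mult poly_eval_prod poly_eval_power poly_eval_Const)

lemma poly_eval_cong: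
  assumes "f \<in> polys n" "\<And>i. i \<in> {1..n} \<Longrightarrow> x i = y i"
  shows "poly_eval x f = poly_eval y f"
  unfolding poly_eval_def
  by (intro sum.cong prod.cong arg_cong2[where f="(*)"] arg_cong2[where f="(^)"] refl assms(2))
     (use assms(1) in \<open>fastforce simp: polys_def\<close>)

lemma poly_eval_polys:
  assumes "f \<in> polys n"
  shows "poly_eval x f = (\<Sum>m\<in>Poly_Mapping.keys f. Poly_Mapping.lookup f m *
     (\<Prod>i\<in>{1..n}. x i ^ Poly_Mapping.lookup m i))"
  unfolding poly_eval_def
  by (intro sum.cong refl arg_cong2[where f="(*)"] monom_eval_superset)
     (use assms in \<open>auto simp: polys_def\<close>)

lemma polys_add: "f \<in> polys n \<Longrightarrow> g \<in> polys n \<Longrightarrow> f + g \<in> polys n"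
  using keys_add[of f g] by (auto simp: polys_def)

lemma polys_Const: "Const c \<in> polys n"
  by (simp add: polys_def Const_def)

lemma polys_Var: "i \<in> {1..n} \<Longrightarrow> Var i \<in> polys n"
  by (simp add: polys_def Var_def)

lemma polys_mult: "f \<in> polys n \<Longrightarrow> g \<in> polys n \<Longrightarrow> f * g \<in> polys n"
  using keys_mult[of f g] unfolding polys_def by (fastforce dest!: keys_add[THEN subsetD])

lemma polys_zero: "0 \<in> polys n"
  by (simp add: polys_def)

lemma polys_one: "1 \<in> polys n"
  using polys_Const[of 1 n] by (simp add: Const_def)

lemma polys_power: "f \<in> polys n \<Longrightarrow> f ^ k \<in> polys n"
  by (induction k) (auto simp: polys_one polys_mult)

lemma polys_sum: "(\<And>i. i \<in> I \<Longrightarrow> f i \<in> polys n) \<Longrightarrow> (\<Sum>i\<in>I. f i) \<in> polys n"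
  by (induction I rule: infinite_finite_induct) (auto simp: polys_zero polys_add)

lemma polys_prod: "(\<And>i. i \<in> I \<Longrightarrow> f i \<in> polys n) \<Longrightarrow> (\<Prod>i\<in>I. f i) \<in> polys n"
  by (induction I rule: infinite_finite_induct) (auto simp: polys_one polys_mult)

lemma polys_subst: "(\<And>i. \<sigma> i \<in> polys k) \<Longrightarrow> poly_subst \<sigma> f \<in> polys k"
  unfolding poly_subst_def by (intro polys_sum polys_mult polys_prod polys_power polys_Const)

text \<open>Kronecker substitution \<open>x\<^sub>1 = t\<close>, \<open>x\<^sub>2 = t ^ N\<close>: for large \<open>N\<close> distinct monomials
  become distinct powers of \<open>t\<close>.\<close>
lemma polys2_zero:
  assumes f: "f \<in> polys 2" and z: "\<And>x. poly_eval x f = 0"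
  shows "f = 0"
proof -
  \<comment> \<open>\<open>N\<close> exceeds every exponent of the first variable in
    \<open>f\<close>, so \<open>e m\<close> has the two exponents of \<open>m\<close> as remainder
    and quotient modulo \<open>N\<close>.\<close>
  define N where "N = Suc (\<Sum>m\<in>Poly_Mapping.keys f. Poly_Mapping.lookup m 1)"
  define e where "e m = Poly_Mapping.lookup m 1 + N * Poly_Mapping.lookup m 2"
    for m :: "nat \<Rightarrow>\<^sub>0 nat"
  have ltN: "Poly_Mapping.lookup m 1 < N" if "m \<in> Poly_Mapping.keys f" for m
    unfolding N_def using that member_le_sum[of m "Poly_Mapping.keys f" "\<lambda>m. Poly_Mapping.lookup m 1"]
    by simp
  have inj: "m = m'" if "m \<in> Poly_Mapping.keys f" "m' \<in> Poly_Mapping.keys f" "e m = e m'" for m m'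
  proof (rule poly_mapping_eqI)
    fix k
    have "e m mod N = e m' mod N" "e m div N = e m' div N" using that(3) by auto
    hence eq: "Poly_Mapping.lookup m 1 = Poly_Mapping.lookup m' 1"
       "Poly_Mapping.lookup m 2 = Poly_Mapping.lookup m' 2"
      using ltN[OF that(1)] ltN[OF that(2)] by (auto simp: e_def)
    have "Poly_Mapping.keys m \<subseteq> {1..2}" "Poly_Mapping.keys m' \<subseteq> {1..2}"
      using f that by (auto simp: polys_def)
    hence "k \<notin> {1..2} \<Longrightarrow> Poly_Mapping.lookup m k = 0 \<and> Poly_Mapping.lookup m' k = 0"
      by (meson in_keys_iff subsetD)
    moreover have "k \<in> {1..2} \<longleftrightarrow> k = 1 \<or> k = 2" by auto
    ultimately show "Poly_Mapping.lookup m k = Poly_Mapping.lookup m' k" using eq by metis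
  qed
  define p where "p = (\<Sum>m\<in>Poly_Mapping.keys f. monom (Poly_Mapping.lookup f m) (e m))"
  have "poly p t = 0" for t
  proof -
    have "poly p t = poly_eval (\<lambda>i. if i = 1 then t else t ^ N) f"
      unfolding poly_eval_polys[OF f] p_def poly_sum poly_monom e_def
      by (intro sum.cong refl) (simp add: numeral_2_eq_2 power_add power_mult)
    thus ?thesis using z by simp
  qed
  hence p0: "p = 0" using poly_all_0_iff_0 by blast
  have "Poly_Mapping.lookup f m = 0" for m
  proof (cases "m \<in> Poly_Mapping.keys f")
    case True
    have "coeff p (e m) = (\<Sum>m'\<in>Poly_Mapping.keys f. if m' = m then Poly_Mapping.lookup f m' else 0)"
      unfolding p_def coeff_sum coeff_monom
      by (intro sum.cong refl) (use inj[OF _ True] in auto)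
    also have "\<dots> = Poly_Mapping.lookup f m" using True by simp
    finally show ?thesis using p0 by simp
  qed (simp add: in_keys_iff)
  thus ?thesis by (intro poly_mapping_eqI) simp
qed

lemma polys2_eqI:
  assumes "f \<in> polys 2" "g \<in> polys 2" "\<And>x. poly_eval x f = poly_eval x g"
  shows "f = g"
proof -
  have m: "- g = Const (-1) * g"
    by (simp add: Const_def single_uminus)
  have "f + - g = 0"
    unfolding m
    by (intro polys2_zero polys_add polys_mult polys_Const assms(1,2))
       (simp add: poly_eval_add poly_eval_mult poly_eval_Const assms)
  thus ?thesis by simp
qed

section \<open>Quadratic polynomials over univariate polynomials\<close>

lemma poly_quadratic: "poly [:a\<^sup>2 + b\<^sup>2, - 2 * a, 1:] t = (t - a)\<^sup>2 + b\<^sup>2" for t :: real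
  by (simp add: power2_eq_square algebra_simps)

text \<open>The quadratic is \<open>(X - z) (X - cnj z)\<close> and vanishes at \<open>z\<close>, so
  \<open>p\<close> and its linear remainder agree there. Horner's scheme builds quotient and
  remainder together.\<close>

lemma real_poly_remainder_at_complex:
  fixes p :: "real poly" and z :: complex
  shows "\<exists>q r0 r1. p = [:(Re z)\<^sup>2 + (Im z)\<^sup>2, - 2 * Re z, 1:] * q + [:r0, r1:]
     \<and> poly (map_poly of_real p) z = of_real r0 + of_real r1 * z"
proof (induction p)
  case 0
  show ?case by (intro exI[of _ 0]) simp
next
  case (pCons c p)
  then obtain q r0 r1 where *: "p = [:(Re z)\<^sup>2 + (Im z)\<^sup>2, - 2 * Re z, 1:] * q + [:r0, r1:]"
     "poly (map_poly of_real p) z = of_real r0 + of_real r1 * z" by blast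
  show ?case
  proof (intro exI conjI)
    have "pCons c p = [:c:] + [:0, 1:] * p" by simp
    also have "\<dots> = [:(Re z)\<^sup>2 + (Im z)\<^sup>2, - 2 * Re z, 1:] * ([:0, 1:] * q) + ([:c:] + [:0, 1:] * [:r0, r1:])"
      by (subst *(1)) (simp only: ring_distribs mult_ac add_ac)
    also have "[:c:] + [:0, 1:] * [:r0, r1:] = [:(Re z)\<^sup>2 + (Im z)\<^sup>2, - 2 * Re z, 1:] * [:r1:] +
       [:c - r1 * ((Re z)\<^sup>2 + (Im z)\<^sup>2), r0 + 2 * Re z * r1:]" by simp
    finally show "pCons c p = [:(Re z)\<^sup>2 + (Im z)\<^sup>2, - 2 * Re z, 1:] * ([:0, 1:] * q + [:r1:]) +
       [:c - r1 * ((Re z)\<^sup>2 + (Im z)\<^sup>2), r0 + 2 * Re z * r1:]" by (simp only: ring_distribs add_ac)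
    show "poly (map_poly of_real (pCons c p)) z =
      of_real (c - r1 * ((Re z)\<^sup>2 + (Im z)\<^sup>2)) + of_real (r0 + 2 * Re z * r1) * z"
      using pCons.hyps by (simp add: map_poly_pCons *(2) complex_eq_iff) (simp add: power2_eq_square algebra_simps)
  qed
qed

text \<open>By continuity. It restores the sign at \<open>a\<close> after a factor
  \<open>(t - a)^2\<close> has been divided out.\<close>

lemma poly_nonneg_off_point:
  fixes q :: "real poly"
  assumes "\<And>t. t \<noteq> a \<Longrightarrow> poly q t \<ge> 0"
  shows "poly q t \<ge> 0"
proof (cases "t = a")
  case True
  have "(poly q \<longlongrightarrow> poly q a) (at a)"
    using poly_isCont[of a q] by (simp add: isCont_def)
  moreover have "\<forall>\<^sub>F t in at a. poly q t \<ge> 0"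
    using assms by (simp add: eventually_at_filter)
  ultimately show ?thesis using True by (auto intro: tendsto_lowerbound)
qed (use assms in simp)

text \<open>A non-real root and its conjugate give the quadratic. At a real root \<open>p\<close>
  has a minimum, so its derivative vanishes and the root is double.\<close>

lemma nonneg_poly_quadratic_factor:
  fixes p :: "real poly"
  assumes nn: "\<And>t. poly p t \<ge> 0" and deg: "degree p > 0"
  obtains a b q where "p = [:a\<^sup>2 + b\<^sup>2, - 2 * a, 1:] * q" "\<And>t. poly q t \<ge> 0"
proof -
  have "degree (map_poly complex_of_real p) = degree p" by (rule degree_map_poly) auto
  hence "\<not> constant (poly (map_poly complex_of_real p))" using deg by (simp add: constant_degree)
  then obtain z where z: "poly (map_poly complex_of_real p) z = 0"
    using fundamental_theorem_of_algebra by blast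
  define a b where "a = Re z" and "b = Im z"
  obtain q r0 r1 where q: "p = [:a\<^sup>2 + b\<^sup>2, - 2 * a, 1:] * q + [:r0, r1:]"
    and r: "complex_of_real r0 + of_real r1 * z = 0"
    using real_poly_remainder_at_complex[of p z] z unfolding a_def b_def by metis
  from r have r': "r0 + r1 * a = 0" "r1 * b = 0" by (auto simp: complex_eq_iff a_def b_def)
  show ?thesis
  proof (cases "b = 0")
    case False
    with r' have "r0 = 0" "r1 = 0" by auto
    with q have pq: "p = [:a\<^sup>2 + b\<^sup>2, - 2 * a, 1:] * q" by simp
    moreover have "poly q t \<ge> 0" for t
    proof -
      have "0 \<le> ((t - a)\<^sup>2 + b\<^sup>2) * poly q t" using nn[of t] unfolding pq poly_mult poly_quadratic .
      moreover have "(t - a)\<^sup>2 + b\<^sup>2 > 0" using False by (simp add: add_nonneg_pos)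
      ultimately show ?thesis by (simp add: zero_le_mult_iff)
    qed
    ultimately show ?thesis using that by blast
  next
    case True
    have "poly p a = 0" using r' unfolding q using True by (simp add: power2_eq_square algebra_simps)
    then obtain g where g: "p = [:- a, 1:] * g" unfolding poly_eq_0_iff_dvd by (auto elim: dvdE)
    have "DERIV (poly p) a :> poly (pderiv p) a" by (rule poly_DERIV)
    hence "poly (pderiv p) a = 0"
      by (rule DERIV_local_min[where d=1]) (use nn \<open>poly p a = 0\<close> in auto)
    hence "poly g a = 0" unfolding g pderiv_mult by (simp add: pderiv_pCons)
    then obtain h where h: "g = [:- a, 1:] * h" unfolding poly_eq_0_iff_dvd by (auto elim: dvdE)
    have ph: "p = [:a\<^sup>2 + b\<^sup>2, - 2 * a, 1:] * h"
      unfolding g h mult.assoc[symmetric] using True by (simp add: power2_eq_square)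
    have "poly h t \<ge> 0" for t
    proof (rule poly_nonneg_off_point[of a])
      fix t assume "t \<noteq> a"
      have "0 \<le> ((t - a)\<^sup>2 + b\<^sup>2) * poly h t" using nn[of t] unfolding ph poly_mult poly_quadratic .
      moreover have "(t - a)\<^sup>2 + b\<^sup>2 > 0" using \<open>t \<noteq> a\<close> by (simp add: add_pos_nonneg)
      ultimately show "poly h t \<ge> 0" by (simp add: zero_le_mult_iff)
    qed
    thus ?thesis using ph that by blast
  qed
qed

lemma degree_linear_comb_le:
  fixes u v :: "real poly"
  assumes "degree u \<le> k" "degree v \<le> k"
  shows "degree ([:a, b:] * u + [:c:] * v) \<le> Suc k"
proof -
  have "degree ([:a, b:] * u) \<le> Suc k"
    by (rule order_trans[OF degree_mult_le]) (use assms in auto)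
  moreover have "degree ([:c:] * v) \<le> Suc k"
    by (rule order_trans[OF degree_mult_le]) (use assms in auto)
  ultimately show ?thesis by (rule degree_add_le)
qed

text \<open>Induction on the degree: split off \<open>(X - a)^2 + b^2\<close> and multiply two sums
  of two squares by Brahmagupta's identity.\<close>

lemma nonneg_poly_two_squares:
  fixes p :: "real poly"
  assumes "\<And>t. poly p t \<ge> 0"
  shows "\<exists>u v. p = u\<^sup>2 + v\<^sup>2 \<and> 2 * degree u \<le> degree p \<and> 2 * degree v \<le> degree p"
  using assms
proof (induction "degree p" arbitrary: p rule: less_induct)
  case less
  show ?case
  proof (cases "degree p = 0")
    case True
    then obtain c where c: "p = [:c:]" by (auto elim: degree_eq_zeroE)
    hence "c \<ge> 0" using less.prems[of 0] by simp
    hence "p = [:sqrt c:]\<^sup>2 + 0\<^sup>2" by (simp add: c power2_eq_square)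
    thus ?thesis by (metis degree_0 degree_pCons_0 mult_0_right zero_le)
  next
    case False
    then obtain a b q where q: "p = [:a\<^sup>2 + b\<^sup>2, - 2 * a, 1:] * q" "\<And>t. poly q t \<ge> 0"
      using nonneg_poly_quadratic_factor[OF less.prems] by blast
    have "q \<noteq> 0" using False q by auto
    hence deg: "degree p = degree q + 2" unfolding q(1) by (subst degree_mult_eq) auto
    obtain u v where uv: "q = u\<^sup>2 + v\<^sup>2" "2 * degree u \<le> degree q" "2 * degree v \<le> degree q"
      using less.hyps[OF _ q(2)] deg by auto
    have "[:a\<^sup>2 + b\<^sup>2, - 2 * a, 1:] = [:- a, 1:]\<^sup>2 + [:b:]\<^sup>2" by (simp add: power2_eq_square)
    hence "p = ([:- a, 1:]\<^sup>2 + [:b:]\<^sup>2) * (u\<^sup>2 + v\<^sup>2)" using q(1) uv(1) by simp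
    also have "\<dots> = ([:- a, 1:] * u + [:b:] * v)\<^sup>2 + ([:- a, 1:] * v + [:- b:] * u)\<^sup>2"
    proof -
      have "[:- b:] = - [:b:]" by simp
      thus ?thesis by algebra
    qed
    finally have "p = \<dots>" .
    moreover have "degree u \<le> degree q div 2" "degree v \<le> degree q div 2" using uv by auto
    note degree_linear_comb_le[OF this, of "- a" 1 b] degree_linear_comb_le[OF this(2,1), of "- a" 1 "- b"]
    ultimately show ?thesis using deg
      by (intro exI[of _ "[:- a, 1:] * u + [:b:] * v"] exI[of _ "[:- a, 1:] * v + [:- b:] * u"]) auto
  qed
qed

text \<open>Allowing \<open>degree u < k\<close>, where both sides are 0, makes it applicable to
  both squares of a sum at once.\<close>

lemma coeff_square_top:
  fixes u :: "real poly"
  assumes "degree u \<le> k"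
  shows "coeff (u\<^sup>2) (2 * k) = (coeff u k)\<^sup>2"
proof (cases "degree u = k")
  case True
  have "coeff (u * u) (degree u + degree u) = coeff u (degree u) * coeff u (degree u)"
    by (rule coeff_mult_degree_sum)
  thus ?thesis using True by (simp add: power2_eq_square mult_2)
next
  case False
  hence "degree u < k" using assms by simp
  moreover have "degree (u\<^sup>2) \<le> degree u * 2" by (rule degree_power_le)
  ultimately show ?thesis by (simp add: coeff_eq_0)
qed

text \<open>Otherwise the coefficient of \<open>h - g^2\<close> in degree
  \<open>2 * degree g\<close> would be minus a nonzero square, whereas a decomposition into two
  squares makes it non-negative.\<close>

lemma degree_le_of_square_le:
  fixes g h :: "real poly"
  assumes "\<And>t. (poly g t)\<^sup>2 \<le> poly h t"
  shows "2 * degree g \<le> degree h"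
proof (rule ccontr)
  assume neg: "\<not> ?thesis"
  let ?p = "h - g\<^sup>2" and ?k = "degree g"
  have "degree (g\<^sup>2) \<le> degree g * 2" by (rule degree_power_le)
  hence "degree ?p \<le> 2 * ?k" using neg by (intro degree_diff_le) auto
  moreover obtain u v where uv: "?p = u\<^sup>2 + v\<^sup>2" "2 * degree u \<le> degree ?p" "2 * degree v \<le> degree ?p"
    using nonneg_poly_two_squares[of ?p] assms by (auto simp: poly_power)
  ultimately have "degree u \<le> ?k" "degree v \<le> ?k" by auto
  hence "coeff ?p (2 * ?k) = (coeff u ?k)\<^sup>2 + (coeff v ?k)\<^sup>2"
    unfolding uv(1) by (simp add: coeff_square_top)
  hence "coeff ?p (2 * ?k) \<ge> 0" by simp
  moreover have "coeff ?p (2 * ?k) = - (lead_coeff g)\<^sup>2"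
    using neg by (simp add: coeff_square_top coeff_eq_0)
  moreover have "lead_coeff g \<noteq> 0" using neg by auto
  ultimately show False by (metis neg_0_le_iff_le not_le zero_less_power2)
qed

text \<open>For vectors \<open>a, b\<close> in the plane the curve \<open>\<theta> \<mapsto> (cos \<theta> a\<^sub>1 + sin \<theta> a\<^sub>2, cos \<theta> b\<^sub>1 + sin \<theta> b\<^sub>2)\<close>
  is an ellipse; the hypotheses say that \<open>(-q, p)\<close> is one of its foci, hence a point of the region it bounds.\<close>
lemma ellipse_focus:
  fixes a1 a2 b1 b2 p q :: real
  assumes n: "a1\<^sup>2 + a2\<^sup>2 - (b1\<^sup>2 + b2\<^sup>2) = q\<^sup>2 - p\<^sup>2" and o: "a1 * b1 + a2 * b2 = - p * q"
  shows "\<exists>\<alpha> \<beta>. \<alpha>\<^sup>2 + \<beta>\<^sup>2 \<le> 1 \<and> \<alpha> * a1 + \<beta> * a2 = - q \<and> \<alpha> * b1 + \<beta> * b2 = p"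
proof -
  define d where "d = a1 * b2 - a2 * b1"
  define aa bb where "aa = a1\<^sup>2 + a2\<^sup>2" and "bb = b1\<^sup>2 + b2\<^sup>2"
  have "d\<^sup>2 + (a1 * b1 + a2 * b2)\<^sup>2 = aa * bb" unfolding d_def aa_def bb_def by algebra
  hence d2: "d\<^sup>2 = aa * bb - p\<^sup>2 * q\<^sup>2" unfolding o by (simp add: power_mult_distrib)
  have ab: "aa - q\<^sup>2 = bb - p\<^sup>2" using n by (simp add: aa_def bb_def)
  show ?thesis
  proof (cases "d = 0")
    case False
    \<comment> \<open>Cramer's rule for the two linear equations, whose determinant is
      \<open>d\<close>.\<close>
    define \<alpha> \<beta> where "\<alpha> = (- q * b2 - p * a2) / d" and "\<beta> = (p * a1 + q * b1) / d"
    have da: "d * \<alpha> = - q * b2 - p * a2" and db: "d * \<beta> = p * a1 + q * b1"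
      using False by (auto simp: \<alpha>_def \<beta>_def)
    have "d * (\<alpha> * a1 + \<beta> * a2) = (d * \<alpha>) * a1 + (d * \<beta>) * a2" by (simp add: algebra_simps)
    also have "\<dots> = d * (- q)" unfolding da db unfolding d_def by algebra
    finally have 1: "\<alpha> * a1 + \<beta> * a2 = - q" by (rule mult_left_cancel[OF False, THEN iffD1])
    have "d * (\<alpha> * b1 + \<beta> * b2) = (d * \<alpha>) * b1 + (d * \<beta>) * b2" by (simp add: algebra_simps)
    also have "\<dots> = d * p" unfolding da db unfolding d_def by algebra
    finally have 2: "\<alpha> * b1 + \<beta> * b2 = p" by (rule mult_left_cancel[OF False, THEN iffD1])
    \<comment> \<open>The slack \<open>d^2 (1 - \<alpha>^2 - \<beta>^2)\<close> turns out to be the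
      square of \<open>aa - q^2\<close>.\<close>
    have "d\<^sup>2 * (\<alpha>\<^sup>2 + \<beta>\<^sup>2) = (d * \<alpha>)\<^sup>2 + (d * \<beta>)\<^sup>2" by (simp add: algebra_simps power_mult_distrib)
    also have "\<dots> = q\<^sup>2 * bb + 2 * p * q * (a1 * b1 + a2 * b2) + p\<^sup>2 * aa"
      unfolding da db aa_def bb_def by algebra
    also have "\<dots> = d\<^sup>2 - (aa - q\<^sup>2) * (bb - p\<^sup>2)" unfolding o d2 by algebra
    also have "\<dots> = d\<^sup>2 - (aa - q\<^sup>2)\<^sup>2" unfolding ab[symmetric] by (simp add: power2_eq_square)
    also have "\<dots> \<le> d\<^sup>2 * 1" by simp
    finally have "\<alpha>\<^sup>2 + \<beta>\<^sup>2 \<le> 1" using False by (simp add: mult_le_cancel_left)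
    with 1 2 show ?thesis by blast
  next
    case True
    have "(aa - q\<^sup>2) * (aa + p\<^sup>2) = 0"
      using d2 ab True by algebra
    hence "aa + p\<^sup>2 = 0 \<or> aa = q\<^sup>2" by auto
    thus ?thesis
    proof
      assume 1: "aa + p\<^sup>2 = 0"
      hence "bb + q\<^sup>2 = 0" using ab by simp
      with 1 have "p = 0" "q = 0" by (auto simp: aa_def bb_def add_nonneg_eq_0_iff)
      thus ?thesis by (intro exI[of _ 0]) simp
    next
      \<comment> \<open>The ellipse has collapsed to a segment or a point with
        \<open>(-q, p)\<close> as an endpoint; the coefficients are read off from whichever of
        \<open>q\<close> and \<open>p\<close> is nonzero.\<close>
      assume aa: "aa = q\<^sup>2"
      hence bb: "bb = p\<^sup>2" using ab by simp
      consider "q \<noteq> 0" | "q = 0" "p \<noteq> 0" | "q = 0" "p = 0" by blast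
      thus ?thesis
      proof cases
        case 1
        have "- a1 / q * a1 + - a2 / q * a2 = - aa / q" using 1 by (simp add: aa_def power2_eq_square field_simps)
        moreover have "- a1 / q * b1 + - a2 / q * b2 = - (a1 * b1 + a2 * b2) / q" using 1 by (simp add: field_simps)
        moreover have "(- a1 / q)\<^sup>2 + (- a2 / q)\<^sup>2 = aa / q\<^sup>2" by (simp add: aa_def power_divide add_divide_distrib)
        ultimately show ?thesis using 1 unfolding aa o
          by (intro exI[of _ "- a1 / q"] exI[of _ "- a2 / q"]) (simp add: power2_eq_square)
      next
        case 2
        hence "a1 = 0" "a2 = 0" using aa by (auto simp: aa_def add_nonneg_eq_0_iff)
        moreover have "b1 / p * b1 + b2 / p * b2 = bb / p" by (simp add: bb_def power2_eq_square add_divide_distrib)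
        moreover have "(b1 / p)\<^sup>2 + (b2 / p)\<^sup>2 = bb / p\<^sup>2" by (simp add: bb_def power_divide add_divide_distrib)
        ultimately show ?thesis using 2 unfolding bb
          by (intro exI[of _ "b1 / p"] exI[of _ "b2 / p"]) (simp add: power2_eq_square)
      next
        case 3
        thus ?thesis by (intro exI[of _ 0]) simp
      qed
    qed
  qed
qed

text \<open>Remainders are written in the basis \<open>1\<close>, \<open>l\<close> because
  \<open>l^2\<close> is \<open>- m^2\<close> modulo the quadratic: there \<open>l\<close> behaves
  like \<open>m\<close> times the imaginary unit.\<close>

lemma poly_mod_irreducible_quadratic:
  fixes p l :: "real poly"
  assumes l: "l = [:- a * s, s:]" and s: "s \<noteq> 0"
  obtains g A B where "p = (l\<^sup>2 + [:m:]\<^sup>2) * g + [:A:] + [:B:] * l"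
proof -
  let ?f = "l\<^sup>2 + [:m:]\<^sup>2"
  have deg: "degree ?f = 2" using s by (simp add: l power2_eq_square numeral_2_eq_2)
  have "degree (p mod ?f) \<le> 1"
  proof -
    have "?f \<noteq> 0" using deg by auto
    from degree_mod_less[OF this, of p] show ?thesis unfolding deg by auto
  qed
  hence "p mod ?f = [:coeff (p mod ?f) 0, coeff (p mod ?f) 1:]"
    by (intro poly_eqI) (auto simp: coeff_pCons coeff_eq_0 split: nat.splits)
  then obtain r0 r1 where r: "p mod ?f = [:r0, r1:]" by blast
  have "p = ?f * (p div ?f) + p mod ?f" by simp
  also have "p mod ?f = [:r0 + a * r1:] + [:r1 / s:] * l" unfolding r using s by (simp add: l)
  finally show ?thesis using that by (simp only: add.assoc)
qed

text \<open>Evaluation at a complex root of \<open>f2 = l^2 + m^2\<close> is replaced by computing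
  modulo \<open>f2\<close> in the basis \<open>1\<close>, \<open>l\<close>. Completing squares with
  \<open>h1\<close> and \<open>h2\<close> leaves \<open>(u^2 + v^2 - w^2) / f2\<close>, which is
  non-negative and hence a sum of two squares.\<close>

lemma nonneg_quadratic_over_polys_rank2:
  fixes f3 f4 l :: "real poly"
  assumes l: "l = [:- a * s, s:]" and s: "s \<noteq> 0" and m: "m \<noteq> 0"
    and d3: "degree f3 \<le> 3" and d4: "degree f4 \<le> 4"
    and nn: "\<And>t. (poly f3 t)\<^sup>2 \<le> poly (l\<^sup>2 + [:m:]\<^sup>2) t * poly f4 t"
  shows "\<exists>h1 h2 r1 r2. degree h1 \<le> 2 \<and> degree h2 \<le> 2 \<and> degree r1 \<le> 2 \<and> degree r2 \<le> 2
    \<and> f3 = l * h1 + [:m:] * h2 \<and> f4 = h1\<^sup>2 + h2\<^sup>2 + r1\<^sup>2 + r2\<^sup>2"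
proof -
  define M where "M = [:m:]"
  define f2 where "f2 = l\<^sup>2 + M\<^sup>2"
  have deg2: "degree f2 = 2" using s by (simp add: f2_def M_def l power2_eq_square numeral_2_eq_2)
  hence f20: "f2 \<noteq> 0" by auto
  have M2: "M\<^sup>2 = f2 - l\<^sup>2" by (simp add: f2_def)
  have f2pos: "poly f2 t > 0" for t
    using m by (simp add: f2_def M_def poly_power add_nonneg_pos)
  have degl: "degree l = 1" using s by (simp add: l)
  define D where "D = f2 * f4 - f3\<^sup>2"
  have "poly D t \<ge> 0" for t using nn[of t] by (simp add: D_def f2_def M_def poly_power)
  then obtain u v where uv: "D = u\<^sup>2 + v\<^sup>2" "2 * degree u \<le> degree D" "2 * degree v \<le> degree D"
    using nonneg_poly_two_squares by blast
  have "degree D \<le> 6" unfolding D_def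
    by (intro degree_diff_le order_trans[OF degree_mult_le] order_trans[OF degree_power_le])
       (use deg2 d3 d4 in auto)
  hence du: "degree u \<le> 3" and dv: "degree v \<le> 3" using uv by auto
  obtain g3 A3 B3 where f3: "f3 = f2 * g3 + [:A3:] + [:B3:] * l"
    using poly_mod_irreducible_quadratic[OF l s, of f3 m] unfolding f2_def M_def by blast
  obtain gu Au Bu where u: "u = f2 * gu + [:Au:] + [:Bu:] * l"
    using poly_mod_irreducible_quadratic[OF l s, of u m] unfolding f2_def M_def by blast
  obtain gv Av Bv where v: "v = f2 * gv + [:Av:] + [:Bv:] * l"
    using poly_mod_irreducible_quadratic[OF l s, of v m] unfolding f2_def M_def by blast
  \<comment> \<open>\<open>K + L l\<close> is the residue of \<open>f3^2 + u^2 + v^2\<close> modulo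
    \<open>f2\<close>. That sum equals \<open>f2 * f4\<close>, so both coordinates must
    vanish.\<close>
  define K L where "K = A3\<^sup>2 + Au\<^sup>2 + Av\<^sup>2 - m\<^sup>2 * (B3\<^sup>2 + Bu\<^sup>2 + Bv\<^sup>2)"
    and "L = 2 * (A3 * B3 + Au * Bu + Av * Bv)"
  have "[:K:] + [:L:] * l = f3\<^sup>2 + u\<^sup>2 + v\<^sup>2 - f2 *
      (f2 * (g3\<^sup>2 + gu\<^sup>2 + gv\<^sup>2) + 2 * g3 * ([:A3:] + [:B3:] * l) + 2 * gu * ([:Au:] + [:Bu:] * l)
        + 2 * gv * ([:Av:] + [:Bv:] * l) + [:B3:]\<^sup>2 + [:Bu:]\<^sup>2 + [:Bv:]\<^sup>2)" (is "_ = _ - f2 * ?G")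
  proof -
    have K: "[:K:] = [:A3:]\<^sup>2 + [:Au:]\<^sup>2 + [:Av:]\<^sup>2 - M\<^sup>2 * ([:B3:]\<^sup>2 + [:Bu:]\<^sup>2 + [:Bv:]\<^sup>2)"
      by (simp add: K_def M_def power2_eq_square)
    have L: "[:L:] = 2 * ([:A3:] * [:B3:] + [:Au:] * [:Bu:] + [:Av:] * [:Bv:])"
      by (simp add: L_def numeral_poly)
    show ?thesis unfolding f3 u v K L M2 by algebra
  qed
  also have "\<dots> = f2 * (f4 - ?G)" using uv(1) D_def by algebra
  finally have dvd: "f2 dvd [:K:] + [:L:] * l" by simp
  have "degree ([:K:] + [:L:] * l) \<le> 1" by (simp add: l)
  hence "[:K:] + [:L:] * l = 0" using dvd_imp_degree_le[OF dvd] deg2 by fastforce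
  hence L0: "L = 0" and K0: "K = 0" using s by (auto simp: l)
  \<comment> \<open>\<open>K = 0\<close> and \<open>L = 0\<close> supply the hypotheses of
    \<open>ellipse_focus\<close>. Its conclusion says that \<open>\<alpha> u + \<beta> v\<close>
    agrees with \<open>i f3\<close> at the root where \<open>l = i m\<close>.\<close>
  obtain \<alpha> \<beta> where ab: "\<alpha>\<^sup>2 + \<beta>\<^sup>2 \<le> 1" "\<alpha> * Au + \<beta> * Av = - (m * B3)" "\<alpha> * (m * Bu) + \<beta> * (m * Bv) = A3"
  proof -
    have "Au\<^sup>2 + Av\<^sup>2 - ((m * Bu)\<^sup>2 + (m * Bv)\<^sup>2) = (m * B3)\<^sup>2 - A3\<^sup>2"
      using K0 unfolding K_def by algebra
    moreover have "Au * (m * Bu) + Av * (m * Bv) = - A3 * (m * B3)"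
      using L0 unfolding L_def by algebra
    ultimately show ?thesis using ellipse_focus that by blast
  qed
  define w where "w = [:\<alpha>:] * u + [:\<beta>:] * v"
  define gw where "gw = [:\<alpha>:] * gu + [:\<beta>:] * gv"
  define C where "C = [:\<alpha> * Bu + \<beta> * Bv:]"
  have MC: "[:A3:] = M * C" using ab(3) by (simp add: M_def C_def algebra_simps)
  have w: "w = f2 * gw - M * [:B3:] + C * l"
  proof -
    have 1: "M * [:B3:] = - ([:\<alpha>:] * [:Au:] + [:\<beta>:] * [:Av:])"
    proof -
      have "[:m * B3:] = [:- (\<alpha> * Au + \<beta> * Av):]" unfolding ab(2) by simp
      thus ?thesis by (simp add: M_def mult.commute)
    qed
    have 2: "C = [:\<alpha>:] * [:Bu:] + [:\<beta>:] * [:Bv:]" by (simp add: C_def)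
    show ?thesis unfolding w_def gw_def u v 1 2 by algebra
  qed
  \<comment> \<open>These are \<open>(l f3 - M w) / f2\<close> and \<open>(M f3 + l w) / f2\<close>,
    with the division carried out by collecting the multiples of \<open>l^2 + M^2\<close>.\<close>
  define h1 h2 where "h1 = l * g3 - M * gw + [:B3:]" and "h2 = M * g3 + l * gw + C"
  have h1: "l * f3 - M * w = f2 * h1"
  proof -
    have "l * f3 - M * w = f2 * (l * g3 - M * gw) + [:B3:] * (l\<^sup>2 + M\<^sup>2)"
      unfolding f3 w MC by algebra
    thus ?thesis unfolding h1_def f2_def[symmetric] by algebra
  qed
  have h2: "M * f3 + l * w = f2 * h2"
  proof -
    have "M * f3 + l * w = f2 * (M * g3 + l * gw) + C * (l\<^sup>2 + M\<^sup>2)"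
      unfolding f3 w MC by algebra
    thus ?thesis unfolding h2_def f2_def[symmetric] by algebra
  qed
  have "f2 * (l * h1 + M * h2) = l * (f2 * h1) + M * (f2 * h2)" by algebra
  also have "\<dots> = (l\<^sup>2 + M\<^sup>2) * f3" unfolding h1[symmetric] h2[symmetric] by algebra
  finally have "f2 * (l * h1 + M * h2) = f2 * f3" unfolding f2_def[symmetric] .
  hence e3: "f3 = l * h1 + M * h2" using f20 by simp
  have "f2 * (f2 * (h1\<^sup>2 + h2\<^sup>2)) = (f2 * h1)\<^sup>2 + (f2 * h2)\<^sup>2" by algebra
  also have "\<dots> = (l\<^sup>2 + M\<^sup>2) * (f3\<^sup>2 + w\<^sup>2)" unfolding h1[symmetric] h2[symmetric] by algebra
  finally have "f2 * (f2 * (h1\<^sup>2 + h2\<^sup>2)) = f2 * (f3\<^sup>2 + w\<^sup>2)" unfolding f2_def[symmetric] .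
  hence hw: "f2 * (h1\<^sup>2 + h2\<^sup>2) = f3\<^sup>2 + w\<^sup>2" using f20 by simp
  have dw: "degree w \<le> 3" unfolding w_def
    by (intro degree_add_le order_trans[OF degree_mult_le]) (use du dv in auto)
  have dh: "degree h \<le> 2" if "degree (f2 * h) \<le> 4" for h
    using that f20 deg2 by (cases "h = 0") (auto simp: degree_mult_eq)
  have dh1: "degree h1 \<le> 2"
    by (intro dh, unfold h1[symmetric], intro degree_diff_le order_trans[OF degree_mult_le])
       (use d3 dw degl in \<open>auto simp: M_def\<close>)
  have dh2: "degree h2 \<le> 2"
    by (intro dh, unfold h2[symmetric], intro degree_add_le order_trans[OF degree_mult_le])
       (use d3 dw degl in \<open>auto simp: M_def\<close>)
  define R where "R = f4 - h1\<^sup>2 - h2\<^sup>2"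
  have dR: "degree R \<le> 4" unfolding R_def
    by (intro degree_diff_le order_trans[OF degree_power_le]) (use dh1 dh2 d4 in auto)
  have "f2 * R = u\<^sup>2 + v\<^sup>2 - w\<^sup>2" using hw uv(1) unfolding R_def D_def by algebra
  hence fR: "poly f2 t * poly R t = (poly u t)\<^sup>2 + (poly v t)\<^sup>2 - (\<alpha> * poly u t + \<beta> * poly v t)\<^sup>2" for t
    unfolding w_def by (metis (no_types) poly_mult poly_diff poly_add poly_power poly_const_conv)
  have "poly R t \<ge> 0" for t
  proof -
    define U V where "U = poly u t" and "V = poly v t"
    \<comment> \<open>Cauchy-Schwarz with \<open>\<alpha>^2 + \<beta>^2 \<le> 1\<close> gives
      \<open>w^2 \<le> u^2 + v^2\<close> pointwise.\<close>
    have "(\<alpha> * U + \<beta> * V)\<^sup>2 \<le> (\<alpha> * U + \<beta> * V)\<^sup>2 + (\<alpha> * V - \<beta> * U)\<^sup>2" by simp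
    also have "\<dots> = (\<alpha>\<^sup>2 + \<beta>\<^sup>2) * (U\<^sup>2 + V\<^sup>2)" by algebra
    also have "\<dots> \<le> 1 * (U\<^sup>2 + V\<^sup>2)" using ab(1) by (intro mult_right_mono) auto
    finally have "(\<alpha> * U + \<beta> * V)\<^sup>2 \<le> U\<^sup>2 + V\<^sup>2" by simp
    hence "poly f2 t * poly R t \<ge> 0" unfolding fR U_def V_def by simp
    thus ?thesis using f2pos[of t] by (simp add: zero_le_mult_iff)
  qed
  then obtain r1 r2 where r: "R = r1\<^sup>2 + r2\<^sup>2" "2 * degree r1 \<le> degree R" "2 * degree r2 \<le> degree R"
    using nonneg_poly_two_squares by blast
  have "f4 = h1\<^sup>2 + h2\<^sup>2 + r1\<^sup>2 + r2\<^sup>2" using r(1) unfolding R_def by algebra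
  moreover have "degree r1 \<le> 2" "degree r2 \<le> 2" using r(2,3) dR by linarith+
  ultimately show ?thesis using e3 dh1 dh2 unfolding M_def by blast
qed

text \<open>The symmetric matrix with rows \<open>f2, f3\<close> and \<open>f3, f4\<close> is
  positive semidefinite at every \<open>t\<close>, and the conclusion factorises it. The cases are
  \<open>f2\<close> zero, a positive constant, with a real double root, or with non-real roots; in
  all but the last \<open>f2\<close> is a square and one completed square suffices.\<close>

lemma nonneg_quadratic_over_polys:
  fixes f2 f3 f4 :: "real poly"
  assumes d2: "degree f2 \<le> 2" and d3: "degree f3 \<le> 3" and d4: "degree f4 \<le> 4"
    and n2: "\<And>t. poly f2 t \<ge> 0" and n4: "\<And>t. poly f4 t \<ge> 0"
    and nn: "\<And>t. (poly f3 t)\<^sup>2 \<le> poly f2 t * poly f4 t"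
  shows "\<exists>l1 l2 q1 q2 q3 q4. degree l1 \<le> 1 \<and> degree l2 \<le> 1
    \<and> degree q1 \<le> 2 \<and> degree q2 \<le> 2 \<and> degree q3 \<le> 2 \<and> degree q4 \<le> 2
    \<and> f2 = l1\<^sup>2 + l2\<^sup>2 \<and> f3 = l1 * q1 + l2 * q2 \<and> f4 = q1\<^sup>2 + q2\<^sup>2 + q3\<^sup>2 + q4\<^sup>2"
proof -
  \<comment> \<open>Completing a single square leaves \<open>f4 - g^2\<close>, which is non-negative
    and so a sum of two squares.\<close>
  have rest: ?thesis if l: "degree l \<le> 1" and g: "degree g \<le> 2" and e: "f2 = l\<^sup>2" "f3 = l * g"
    and n: "\<And>t. (poly g t)\<^sup>2 \<le> poly f4 t" for l g
  proof -
    have "poly (f4 - g\<^sup>2) t \<ge> 0" for t using n[of t] by (simp add: poly_power)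
    then obtain r1 r2 where r: "f4 - g\<^sup>2 = r1\<^sup>2 + r2\<^sup>2" "2 * degree r1 \<le> degree (f4 - g\<^sup>2)" "2 * degree r2 \<le> degree (f4 - g\<^sup>2)"
      using nonneg_poly_two_squares by blast
    have "degree (f4 - g\<^sup>2) \<le> 4"
      by (intro degree_diff_le order_trans[OF degree_power_le]) (use d4 g in auto)
    hence "degree r1 \<le> 2" "degree r2 \<le> 2" using r(2,3) by linarith+
    moreover have "f4 = g\<^sup>2 + r1\<^sup>2 + r2\<^sup>2" using r(1) by algebra
    hence "f4 = g\<^sup>2 + 0\<^sup>2 + r1\<^sup>2 + r2\<^sup>2" by simp
    moreover have "f2 = l\<^sup>2 + 0\<^sup>2" "f3 = l * g + 0 * 0" using e by simp_all
    moreover have "degree (0 :: real poly) \<le> 1" "degree (0 :: real poly) \<le> 2" by simp_all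
    ultimately show ?thesis using l g by blast
  qed
  consider "f2 = 0" | "f2 \<noteq> 0" "degree f2 = 0" | "degree f2 > 0" by blast
  thus ?thesis
  proof cases
    case 1
    hence "poly f3 t = 0" for t using nn[of t] by simp
    hence "f3 = 0" using poly_all_0_iff_0 by blast
    thus ?thesis using 1 n4 by (intro rest[of 0 0]) auto
  next
    case 2
    then obtain c where c: "f2 = [:c:]" by (auto elim: degree_eq_zeroE)
    hence cpos: "c > 0" using n2[of 0] 2 by simp
    define s where "s = sqrt c"
    have s: "s > 0" "s\<^sup>2 = c" using cpos by (auto simp: s_def)
    have le: "(poly ([:1 / s:] * f3) t)\<^sup>2 \<le> poly f4 t" for t
      using nn[of t] s cpos by (simp add: c power_mult_distrib power_divide divide_le_eq mult.commute)
    \<comment> \<open>A priori \<open>f3 / s\<close> may have degree 3; the better bound holds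
      because its square lies below \<open>f4\<close>.\<close>
    have "2 * degree ([:1 / s:] * f3) \<le> degree f4" by (rule degree_le_of_square_le[OF le])
    hence "degree ([:1 / s:] * f3) \<le> 2" using d4 by linarith
    moreover have "[:s:]\<^sup>2 = f2" using s by (simp add: c power2_eq_square)
    moreover have "[:s:] * ([:1 / s:] * f3) = f3" using s by simp
    ultimately show ?thesis using le by (intro rest[of "[:s:]" "[:1 / s:] * f3"]) auto
  next
    case 3
    obtain a b q where q: "f2 = [:a\<^sup>2 + b\<^sup>2, - 2 * a, 1:] * q" "\<And>t. poly q t \<ge> 0"
      using nonneg_poly_quadratic_factor[OF n2 3] by blast
    have "q \<noteq> 0" using 3 q by auto
    hence "degree f2 = degree q + 2" unfolding q(1) by (subst degree_mult_eq) auto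
    hence "degree q = 0" using d2 by simp
    then obtain c where c: "q = [:c:]" by (auto elim: degree_eq_zeroE)
    hence cpos: "c > 0" using q(2)[of 0] \<open>q \<noteq> 0\<close> by simp
    define s where "s = sqrt c"
    have s: "s > 0" "s * s = c" using cpos by (auto simp: s_def)
    define l where "l = [:- a * s, s:]"
    have f2: "f2 = l\<^sup>2 + [:s * b:]\<^sup>2"
      using s(2)[symmetric] by (simp add: q(1) c l_def power2_eq_square algebra_simps)
    show ?thesis
    proof (cases "b = 0")
      case True
      hence f2l: "f2 = l\<^sup>2" using f2 by simp
      have la: "poly l t = s * (t - a)" for t by (simp add: l_def algebra_simps)
      \<comment> \<open>At the double root of \<open>f2\<close> the inequality forces
        \<open>f3\<close> to vanish, so \<open>l\<close> divides \<open>f3\<close>.\<close>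
      have "poly f3 a = 0" using nn[of a] by (simp add: f2l poly_power la)
      then obtain h where h: "f3 = [:- a, 1:] * h" unfolding poly_eq_0_iff_dvd by (auto elim: dvdE)
      define g where "g = [:1 / s:] * h"
      have lg: "f3 = l * g"
      proof -
        have "l = [:s:] * [:- a, 1:]" by (simp add: l_def)
        moreover have "h = [:s:] * g" using s by (simp add: g_def)
        moreover have "[:s:] * [:1 / s:] = 1" using s by simp
        ultimately show ?thesis unfolding h g_def by algebra
      qed
      have l0: "l \<noteq> 0" and dl: "degree l = 1" using s by (auto simp: l_def)
      have dg: "degree g \<le> 2" using d3 lg l0 dl by (cases "g = 0") (auto simp: degree_mult_eq)
      have "poly (f4 - g\<^sup>2) t \<ge> 0" for t
      proof (rule poly_nonneg_off_point[of a])
        fix t assume "t \<noteq> a"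
        hence "(poly l t)\<^sup>2 > 0" using s by (simp add: la)
        moreover have "(poly l t)\<^sup>2 * (poly g t)\<^sup>2 \<le> (poly l t)\<^sup>2 * poly f4 t"
          using nn[of t] by (simp add: f2l lg poly_power power_mult_distrib)
        ultimately have "(poly g t)\<^sup>2 \<le> poly f4 t" by (simp add: mult_le_cancel_left)
        thus "poly (f4 - g\<^sup>2) t \<ge> 0" by (simp add: poly_power)
      qed
      hence "(poly g t)\<^sup>2 \<le> poly f4 t" for t by (simp add: poly_power)
      thus ?thesis using dl dg f2l lg by (intro rest[of l g]) auto
    next
      case False
      hence "s * b \<noteq> 0" "s \<noteq> 0" using s by auto
      obtain h1 h2 r1 r2 where "degree h1 \<le> 2" "degree h2 \<le> 2" "degree r1 \<le> 2" "degree r2 \<le> 2"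
        "f3 = l * h1 + [:s * b:] * h2" "f4 = h1\<^sup>2 + h2\<^sup>2 + r1\<^sup>2 + r2\<^sup>2"
        using nonneg_quadratic_over_polys_rank2[OF l_def \<open>s \<noteq> 0\<close> \<open>s * b \<noteq> 0\<close> d3 d4 nn[unfolded f2]] by blast
      moreover have "degree l \<le> 1" by (simp add: l_def)
      moreover have "degree [:s * b:] \<le> 1" by simp
      ultimately show ?thesis using f2 by blast
    qed
  qed
qed

section \<open>Ternary quartic forms\<close>

text \<open>Homogeneous polynomials in three variables, taken as functions. Generating them from
  linear functionals makes invariance under linear changes of coordinates a plain induction.\<close>

inductive form :: "nat \<Rightarrow> (real^3 \<Rightarrow> real) \<Rightarrow> bool" where
  form_const: "form 0 (\<lambda>_. c)"
| form_linear_mult: "linear l \<Longrightarrow> form k F \<Longrightarrow> form (Suc k) (\<lambda>v. l v * F v)"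
| form_add: "form k F \<Longrightarrow> form k G \<Longrightarrow> form k (\<lambda>v. F v + G v)"

section \<open>Closure properties of forms\<close>

lemma form_scale: "form k F \<Longrightarrow> form k (\<lambda>v. c * F v)"
proof (induction rule: form.induct)
  case (form_linear_mult l k F)
  from form.form_linear_mult[OF this(1,3)] show ?case by (simp add: mult.left_commute)
next
  case (form_add k F G)
  from form.form_add[OF form_add.IH] show ?case by (simp add: distrib_left)
qed (rule form_const)

lemma form_mult: "form j F \<Longrightarrow> form k G \<Longrightarrow> form (j + k) (\<lambda>v. F v * G v)"
proof (induction rule: form.induct)
  case (form_const c)
  thus ?case by (simp add: form_scale)
next
  case (form_linear_mult l j F)
  hence "form (Suc (j + k)) (\<lambda>v. l v * (F v * G v))" by (intro form.form_linear_mult)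
  thus ?case by (simp add: mult.assoc)
next
  case (form_add j F H)
  hence "form (j + k) (\<lambda>v. F v * G v + H v * G v)" by (intro form.form_add)
  thus ?case by (simp add: distrib_right)
qed

lemma form_linear: "linear l \<Longrightarrow> form 1 l"
  using form_linear_mult[OF _ form_const, of l 1] by simp

lemma form_power: "form k F \<Longrightarrow> form (k * e) (\<lambda>v. F v ^ e)"
proof (induction e)
  case 0
  show ?case using form_const[of 1] by simp
next
  case (Suc e)
  from form_mult[OF Suc.prems Suc.IH[OF Suc.prems]] show ?case by simp
qed

lemma form_zero: "form k (\<lambda>_. 0)"
proof (induction k)
  case (Suc k)
  from form_linear_mult[OF bounded_linear.linear[OF bounded_linear_zero] this] show ?case by simp
qed (rule form_const)

lemma form_sum: "(\<And>i. i \<in> I \<Longrightarrow> form k (F i)) \<Longrightarrow> form k (\<lambda>v. \<Sum>i\<in>I. F i v)"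
proof (induction I rule: infinite_finite_induct)
  case (insert i I)
  hence "form k (\<lambda>v. F i v + (\<Sum>i\<in>I. F i v))" by (intro form_add) auto
  thus ?case using insert by simp
qed (simp_all add: form_zero)

lemma form_prod: "(\<And>i. i \<in> I \<Longrightarrow> form (k i) (F i)) \<Longrightarrow> form (\<Sum>i\<in>I. k i) (\<lambda>v. \<Prod>i\<in>I. F i v)"
proof (induction I rule: infinite_finite_induct)
  case (insert i I)
  hence "form (k i + (\<Sum>i\<in>I. k i)) (\<lambda>v. F i v * (\<Prod>i\<in>I. F i v))" by (intro form_mult) auto
  thus ?case using insert by simp
qed (use form_const[of 1] in auto)

lemma form_compose: "form k F \<Longrightarrow> linear T \<Longrightarrow> form k (\<lambda>v. F (T v))"
proof (induction rule: form.induct)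
  case (form_linear_mult l k F)
  have "linear (\<lambda>v. l (T v))"
    using linear_compose[OF form_linear_mult.prems form_linear_mult.hyps(1)] by (simp add: o_def)
  thus ?case using form_linear_mult by (intro form.form_linear_mult) auto
qed (auto intro: form.intros)

lemma form_continuous: "form k F \<Longrightarrow> continuous_on A F"
  by (induction rule: form.induct)
     (auto intro!: continuous_intros intro: linear_continuous_on simp: linear_conv_bounded_linear)

lemma form_homogeneous: "form k F \<Longrightarrow> F (s *\<^sub>R v) = s ^ k * F v"
  by (induction rule: form.induct) (auto simp: linear_cmul algebra_simps)

lemma linear_nth: "linear (\<lambda>v::real^3. v $ i)"
  by (simp add: bounded_linear_vec_nth bounded_linear.linear)

lemma linear_vector_3:
  fixes l :: "real^3 \<Rightarrow> real"
  assumes "linear l"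
  shows "l (vector [x, y, z]) = x * l (axis 1 1) + y * l (axis 2 1) + z * l (axis 3 1)"
proof -
  have "(vector [x, y, z] :: real^3) = x *\<^sub>R axis 1 1 + y *\<^sub>R axis 2 1 + z *\<^sub>R axis 3 1"
    by (simp add: vec_eq_iff forall_3 axis_def)
  thus ?thesis using assms by (simp add: linear_add linear_cmul)
qed

text \<open>Multiplication by the linear form \<open>a x + b t + c\<close> turns the coefficient of
  \<open>x ^ i\<close> into \<open>a * p (i - 1) + (b t + c) * p i\<close>. The vanishing of
  \<open>p i\<close> beyond \<open>k\<close> keeps this uniform in \<open>i\<close>.\<close>

lemma form_expansion:
  assumes "form k F"
  shows "\<exists>p :: nat \<Rightarrow> real poly. (\<forall>i>k. p i = 0) \<and> (\<forall>i\<le>k. degree (p i) \<le> k - i)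
    \<and> (\<forall>x t. F (vector [x, t, 1]) = (\<Sum>i\<le>k. poly (p i) t * x ^ i)) \<and> F (axis 1 1) = coeff (p k) 0"
  using assms
proof (induction rule: form.induct)
  case (form_const c)
  show ?case by (intro exI[of _ "\<lambda>i. if i = 0 then [:c:] else 0"]) auto
next
  case (form_linear_mult l k F)
  then obtain p where p: "\<And>i. i > k \<Longrightarrow> p i = 0" "\<And>i. i \<le> k \<Longrightarrow> degree (p i) \<le> k - i"
    "\<And>x t. F (vector [x, t, 1]) = (\<Sum>i\<le>k. poly (p i) t * x ^ i)" "F (axis 1 1) = coeff (p k) 0"
    by blast
  define a b c where "a = l (axis 1 1)" and "b = l (axis 2 1)" and "c = l (axis 3 1)"
  define p' where "p' i = [:a:] * (case i of 0 \<Rightarrow> 0 | Suc j \<Rightarrow> p j) + [:c, b:] * p i" for i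
  have "degree (p' i) \<le> Suc k - i" if "i \<le> Suc k" for i
  proof -
    have "degree ([:a:] * (case i of 0 \<Rightarrow> 0 | Suc j \<Rightarrow> p j)) \<le> Suc k - i"
      using that by (intro order_trans[OF degree_mult_le]) (auto split: nat.split intro: p(2))
    moreover have "degree ([:c, b:] * p i) \<le> Suc k - i"
    proof (cases "i \<le> k")
      case True
      have "degree ([:c, b:] * p i) \<le> degree [:c, b:] + degree (p i)" by (rule degree_mult_le)
      also have "\<dots> \<le> 1 + (k - i)" using p(2)[OF True] by (intro add_mono) auto
      finally show ?thesis using True by simp
    qed (simp add: p(1))
    ultimately show ?thesis unfolding p'_def by (rule degree_add_le)
  qed
  moreover have "p' i = 0" if "i > Suc k" for i
    using that p(1) by (auto simp: p'_def split: nat.split)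
  moreover have "l (vector [x, t, 1]) * F (vector [x, t, 1]) = (\<Sum>i\<le>Suc k. poly (p' i) t * x ^ i)" for x t
  proof -
    have "(\<Sum>i\<le>Suc k. poly (p' i) t * x ^ i) =
       (\<Sum>i\<le>Suc k. poly (case i of 0 \<Rightarrow> 0 | Suc j \<Rightarrow> p j) t * a * x ^ i) + (\<Sum>i\<le>Suc k. poly (p i) t * (b * t + c) * x ^ i)"
      unfolding sum.distrib[symmetric] by (intro sum.cong refl) (simp add: p'_def algebra_simps)
    also have "(\<Sum>i\<le>Suc k. poly (case i of 0 \<Rightarrow> 0 | Suc j \<Rightarrow> p j) t * a * x ^ i) = (\<Sum>i\<le>k. poly (p i) t * a * x ^ Suc i)"
      by (subst sum.atMost_Suc_shift) simp
    also have "(\<Sum>i\<le>Suc k. poly (p i) t * (b * t + c) * x ^ i) = (\<Sum>i\<le>k. poly (p i) t * (b * t + c) * x ^ i)"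
      by (simp add: p(1))
    also have "(\<Sum>i\<le>k. poly (p i) t * a * x ^ Suc i) + \<dots> = (x * a + t * b + c) * (\<Sum>i\<le>k. poly (p i) t * x ^ i)"
      unfolding sum_distrib_left sum.distrib[symmetric] by (intro sum.cong refl) (simp add: algebra_simps)
    finally show ?thesis using linear_vector_3[OF form_linear_mult.hyps(1)] p(3) by (simp add: a_def b_def c_def)
  qed
  moreover have "l (axis 1 1) * F (axis 1 1) = coeff (p' (Suc k)) 0"
    by (simp add: p'_def p(1,4) a_def)
  ultimately show ?case by blast
next
  case (form_add k F G)
  then obtain p q where p: "\<And>i. i > k \<Longrightarrow> p i = 0" "\<And>i. i \<le> k \<Longrightarrow> degree (p i) \<le> k - i"
    "\<And>x t. F (vector [x, t, 1]) = (\<Sum>i\<le>k. poly (p i) t * x ^ i)" "F (axis 1 1) = coeff (p k) 0"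
    and q: "\<And>i. i > k \<Longrightarrow> q i = 0" "\<And>i. i \<le> k \<Longrightarrow> degree (q i) \<le> k - i"
    "\<And>x t. G (vector [x, t, 1]) = (\<Sum>i\<le>k. poly (q i) t * x ^ i)" "G (axis 1 1) = coeff (q k) 0"
    by blast
  show ?case
    by (intro exI[of _ "\<lambda>i. p i + q i"])
       (auto simp: p q sum.distrib algebra_simps intro!: degree_add_le)
qed

text \<open>A polynomial of degree at most 3 that is a sum of two squares is one of two affine
  squares. So the cubic term is absent, and the discriminant inequality is Lagrange's
  identity.\<close>

lemma nonneg_cubic:
  fixes a b c d :: real
  assumes "\<And>x. a * x ^ 3 + b * x\<^sup>2 + c * x + d \<ge> 0"
  shows "a = 0" "b \<ge> 0" "d \<ge> 0" "c\<^sup>2 \<le> 4 * b * d"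
proof -
  let ?p = "[:d, c, b, a:]"
  have "poly ?p x \<ge> 0" for x using assms[of x] by (simp add: algebra_simps power3_eq_cube power2_eq_square)
  then obtain u v where uv: "?p = u\<^sup>2 + v\<^sup>2" "2 * degree u \<le> degree ?p" "2 * degree v \<le> degree ?p"
    using nonneg_poly_two_squares by blast
  have "degree ?p \<le> 3" by simp
  have lin: "w = [:coeff w 0, coeff w 1:]" if "2 * degree w \<le> degree ?p" for w :: "real poly"
  proof -
    have "degree w \<le> 1" using that \<open>degree ?p \<le> 3\<close> by linarith
    thus ?thesis by (intro poly_eqI) (auto simp: coeff_pCons coeff_eq_0 split: nat.splits)
  qed
  obtain u0 u1 where u: "u = [:u0, u1:]" using lin[OF uv(2)] by blast
  obtain v0 v1 where v: "v = [:v0, v1:]" using lin[OF uv(3)] by blast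
  have e: "a = 0" "b = u1\<^sup>2 + v1\<^sup>2" "c = 2 * (u0 * u1 + v0 * v1)" "d = u0\<^sup>2 + v0\<^sup>2"
    using uv(1) unfolding u v by (auto simp: power2_eq_square)
  show "a = 0" "b \<ge> 0" "d \<ge> 0" using e by auto
  have "4 * b * d - c\<^sup>2 = (2 * (u0 * v1 - u1 * v0))\<^sup>2" unfolding e(2-) by algebra
  also have "\<dots> \<ge> 0" by simp
  finally show "c\<^sup>2 \<le> 4 * b * d" by simp
qed

section \<open>Forms and their restrictions to the plane \<open>z = 1\<close>\<close>

lemma poly_eq_sum_le:
  fixes p :: "real poly"
  assumes "degree p \<le> n"
  shows "poly p x = (\<Sum>i\<le>n. coeff p i * x ^ i)"
  unfolding poly_altdef
  by (rule sum.mono_neutral_left) (use assms in \<open>auto simp: coeff_eq_0\<close>)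

text \<open>Homogenisation of \<open>x l(t) + q(t)\<close>, where \<open>deg l \<le> 1\<close> and \<open>deg q \<le> 2\<close>.\<close>
definition homogenise :: "real poly \<Rightarrow> real poly \<Rightarrow> real^3 \<Rightarrow> real" where
  "homogenise l q v = v $ 1 * (coeff l 1 * v $ 2 + coeff l 0 * v $ 3)
     + (coeff q 2 * v $ 2 * v $ 2 + coeff q 1 * v $ 2 * v $ 3 + coeff q 0 * v $ 3 * v $ 3)"

lemma form_homogenise: "form 2 (homogenise l q)"
proof -
  have m: "form 2 (\<lambda>v. c * (v $ i * v $ j))" for c i j
    using form_scale[OF form_mult[OF form_linear[OF linear_nth] form_linear[OF linear_nth]]]
    by (simp add: numeral_2_eq_2)
  have "homogenise l q = (\<lambda>v. coeff l 1 * (v $ 1 * v $ 2) + coeff l 0 * (v $ 1 * v $ 3)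
     + (coeff q 2 * (v $ 2 * v $ 2) + coeff q 1 * (v $ 2 * v $ 3) + coeff q 0 * (v $ 3 * v $ 3)))"
    by (auto simp: homogenise_def algebra_simps)
  thus ?thesis by (simp only:) (intro form_add m)
qed

lemma homogenise_vector:
  assumes "degree l \<le> 1" "degree q \<le> 2"
  shows "homogenise l q (vector [x, t, 1]) = x * poly l t + poly q t"
  unfolding homogenise_def poly_eq_sum_le[OF assms(1)] poly_eq_sum_le[OF assms(2)]
  by (simp add: numeral_2_eq_2 algebra_simps)

lemma affine_normalisation:
  fixes v :: "real^3"
  assumes "v $ 3 \<noteq> 0"
  shows "v = (v $ 3) *\<^sub>R vector [v $ 1 / v $ 3, v $ 2 / v $ 3, 1]"
  using assms by (simp add: vec_eq_iff forall_3)

lemma form_tendsto_perturbed: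
  assumes "form k F"
  shows "(\<lambda>s. F (v + s *\<^sub>R axis 3 1)) \<midarrow>0\<rightarrow> F v"
proof -
  have "continuous_on UNIV (\<lambda>s::real. F (v + s *\<^sub>R axis 3 1))"
    by (intro continuous_intros continuous_on_compose2[OF form_continuous[OF assms]]) auto
  hence "isCont (\<lambda>s::real. F (v + s *\<^sub>R axis 3 1)) 0" by (simp add: continuous_on_eq_continuous_at)
  thus ?thesis by (simp add: isCont_def)
qed

lemma eventually_perturbed_nth_3:
  fixes v :: "real^3"
  shows "\<forall>\<^sub>F s in at 0. (v + s *\<^sub>R axis 3 1) $ 3 \<noteq> 0"
proof (cases "v $ 3 = 0")
  case True
  thus ?thesis by (simp add: eventually_at_filter axis_def)
next
  case False
  thus ?thesis
    by (intro eventually_at[THEN iffD2] exI[of _ "\<bar>v $ 3\<bar>"]) (auto simp: axis_def)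
qed

text \<open>The plane \<open>v\<^sub>3 = 0\<close> has dense complement, whose points are multiples of points \<open>(x, t, 1)\<close>.\<close>
lemma form_eqI:
  assumes F: "form k F" and G: "form k G"
    and eq: "\<And>x t. F (vector [x, t, 1]) = G (vector [x, t, 1])"
  shows "F v = G v"
proof -
  have "(\<lambda>s. F (v + s *\<^sub>R axis 3 1)) \<midarrow>0\<rightarrow> F v"
    by (rule form_tendsto_perturbed[OF F])
  moreover have "\<forall>\<^sub>F s in at 0. F (v + s *\<^sub>R axis 3 1) = G (v + s *\<^sub>R axis 3 1)"
    using eventually_perturbed_nth_3[of v]
  proof eventually_elim
    case (elim s)
    let ?w = "v + s *\<^sub>R axis 3 1"
    show ?case
      by (subst (1 2) affine_normalisation[OF elim])
         (simp only: form_homogeneous[OF F] form_homogeneous[OF G] eq)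
  qed
  ultimately have "(\<lambda>s. G (v + s *\<^sub>R axis 3 1)) \<midarrow>0\<rightarrow> F v"
    by (rule Lim_transform_eventually)
  moreover have "(\<lambda>s. G (v + s *\<^sub>R axis 3 1)) \<midarrow>0\<rightarrow> G v"
    by (rule form_tendsto_perturbed[OF G])
  ultimately show ?thesis by (rule LIM_unique)
qed

text \<open>The same density argument as for \<open>form_eqI\<close>; evenness of \<open>k\<close>
  makes the power of the scaling factor non-negative.\<close>

lemma form_nonneg:
  assumes F: "form k F" and nn: "\<And>x t. F (vector [x, t, 1]) \<ge> 0" and "even k"
  shows "F v \<ge> 0"
proof -
  have "(\<lambda>s. F (v + s *\<^sub>R axis 3 1)) \<midarrow>0\<rightarrow> F v"
    by (rule form_tendsto_perturbed[OF F])
  moreover have "\<forall>\<^sub>F s in at 0. F (v + s *\<^sub>R axis 3 1) \<ge> 0"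
    using eventually_perturbed_nth_3[of v]
  proof eventually_elim
    case (elim s)
    show ?case
      by (subst affine_normalisation[OF elim])
         (simp add: form_homogeneous[OF F] nn zero_le_even_power \<open>even k\<close>)
  qed
  ultimately show ?thesis by (rule tendsto_lowerbound) simp
qed

text \<open>On \<open>z = 1\<close> the zero removes the term in \<open>x ^ 4\<close> and
  non-negativity then that in \<open>x ^ 3\<close>. The remaining quadratic in \<open>x\<close>
  satisfies the discriminant condition of \<open>nonneg_quadratic_over_polys\<close>, and
  homogenising the resulting squares gives forms.\<close>

lemma nonneg_quartic_form_with_zero:
  assumes F: "form 4 F" and nn: "\<And>v. F v \<ge> 0" and z: "F (axis 1 1) = 0"
  shows "\<exists>Q. (\<forall>j<4. form 2 (Q j)) \<and> (\<forall>v. F v = (\<Sum>j<(4::nat). (Q j v)\<^sup>2))"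
proof -
  obtain p where p: "\<And>i. i \<le> 4 \<Longrightarrow> degree (p i) \<le> 4 - i"
    "\<And>x t. F (vector [x, t, 1]) = (\<Sum>i\<le>4. poly (p i) t * x ^ i)" "F (axis 1 1) = coeff (p 4) 0"
    using form_expansion[OF F] by blast
  have "degree (p 4) = 0" using p(1)[of 4] by simp
  hence p4: "poly (p 4) t = 0" for t using p(3) z by (auto elim!: degree_eq_zeroE)
  have F4: "F (vector [x, t, 1]) = poly (p 3) t * x ^ 3 + poly (p 2) t * x\<^sup>2 + poly (p 1) t * x + poly (p 0) t" for x t
  proof -
    have "{..4} = {0, 1, 2, 3, 4 :: nat}" by auto
    thus ?thesis unfolding p(2) by (simp add: p4)
  qed
  note c = nonneg_cubic[OF nn[of "vector [_, _, 1]", unfolded F4]]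
  have p3: "poly (p 3) t = 0" for t by (rule c(1))
  \<comment> \<open>The middle coefficient of the quadratic in \<open>x\<close> is taken as
    \<open>2 * f3\<close>.\<close>
  define f3 where "f3 = smult (1/2) (p 1)"
  have "degree (p 2) \<le> 2" "degree f3 \<le> 3" "degree (p 0) \<le> 4"
    using p(1)[of 2] p(1)[of 1] p(1)[of 0] by (auto simp: f3_def)
  moreover have "poly (p 2) t \<ge> 0" "poly (p 0) t \<ge> 0" for t by (rule c(2), rule c(3))
  moreover have "(poly f3 t)\<^sup>2 \<le> poly (p 2) t * poly (p 0) t" for t
    using c(4)[of t] by (simp add: f3_def power_divide)
  ultimately obtain l1 l2 q1 q2 q3 q4 where d: "degree l1 \<le> 1" "degree l2 \<le> 1"
    "degree q1 \<le> 2" "degree q2 \<le> 2" "degree q3 \<le> 2" "degree q4 \<le> 2"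
    and e: "p 2 = l1\<^sup>2 + l2\<^sup>2" "f3 = l1 * q1 + l2 * q2" "p 0 = q1\<^sup>2 + q2\<^sup>2 + q3\<^sup>2 + q4\<^sup>2"
    using nonneg_quadratic_over_polys by metis
  define Q where "Q j = (if j = 0 then homogenise l1 q1 else if j = 1 then homogenise l2 q2
     else if j = 2 then homogenise 0 q3 else homogenise 0 q4)" for j :: nat
  have fQ: "form 2 (Q j)" for j by (simp add: Q_def form_homogenise)
  have S: "form 4 (\<lambda>v. \<Sum>j<(4::nat). (Q j v)\<^sup>2)"
    using form_power[OF fQ, of 2] by (intro form_sum) simp
  have "F (vector [x, t, 1]) = (\<Sum>j<(4::nat). (Q j (vector [x, t, 1]))\<^sup>2)" for x t
  proof -
    have p1: "poly (p 1) t = 2 * poly f3 t" by (simp add: f3_def)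
    have "degree (0 :: real poly) \<le> 1" by simp
    note h = homogenise_vector[OF d(1,3)] homogenise_vector[OF d(2,4)]
      homogenise_vector[OF this d(5)] homogenise_vector[OF this d(6)]
    have "(\<Sum>j<(4::nat). (Q j (vector [x, t, 1]))\<^sup>2) =
      (x * poly l1 t + poly q1 t)\<^sup>2 + (x * poly l2 t + poly q2 t)\<^sup>2 + (poly q3 t)\<^sup>2 + (poly q4 t)\<^sup>2"
      by (simp add: eval_nat_numeral Q_def h)
    also have "\<dots> = F (vector [x, t, 1])"
      unfolding F4 p3 p1 e poly_add poly_mult poly_power by algebra
    finally show ?thesis by simp
  qed
  thus ?thesis using fQ form_eqI[OF F S] by blast
qed

text \<open>Hilbert's theorem on ternary quartics, here with five squares: four for the form with a
  zero and one for the subtracted multiple of \<open>(v \<bullet> v)^2\<close>.\<close>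

theorem nonneg_ternary_quartic_form:
  assumes F: "form 4 F" and nn: "\<And>v. F v \<ge> 0"
  shows "\<exists>Q. (\<forall>j<5. form 2 (Q j)) \<and> (\<forall>v. F v = (\<Sum>j<(5::nat). (Q j v)\<^sup>2))"
proof -
  obtain v0 :: "real^3" where v0: "norm v0 = 1" "\<And>v. norm v = 1 \<Longrightarrow> F v0 \<le> F v"
  proof -
    have "sphere (0::real^3) 1 \<noteq> {}" by simp
    from continuous_attains_inf[OF compact_sphere this form_continuous[OF F]] show ?thesis
      using that by auto
  qed
  define e where "e = F v0"
  have e: "e \<ge> 0" by (simp add: e_def nn)
  have N: "form 2 (\<lambda>v. v \<bullet> v)"
  proof -
    have "form 2 (\<lambda>v::real^3. v $ i * v $ i)" for i
      using form_mult[OF form_linear[OF linear_nth] form_linear[OF linear_nth]]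
      by (simp add: numeral_2_eq_2)
    from form_sum[of UNIV, OF this] show ?thesis by (simp add: inner_vec_def)
  qed
  \<comment> \<open>As \<open>e\<close> is the minimum of \<open>F\<close> on the unit sphere,
    \<open>G\<close> is non-negative everywhere by homogeneity and vanishes at
    \<open>v0\<close>.\<close>
  define G where "G v = F v + (- e) * (v \<bullet> v)\<^sup>2" for v
  have fG: "form 4 G" unfolding G_def
    using form_power[OF N, of 2] by (intro form_add F form_scale) simp
  have G0: "G v \<ge> 0" for v
  proof (cases "v = 0")
    case False
    define w where "w = v /\<^sub>R norm v"
    have w: "norm w = 1" "v = norm v *\<^sub>R w" using False by (auto simp: w_def)
    have "G w \<ge> 0" using v0(2)[OF w(1)] w(1) by (simp add: G_def e_def dot_square_norm)
    thus ?thesis using form_homogeneous[OF fG, of "norm v" w] w(2) by simp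
  qed (simp add: G_def nn)
  have "norm (axis 1 1 :: real^3) = norm v0" using v0(1) by (simp add: norm_axis_1)
  then obtain T :: "real^3 \<Rightarrow> real^3" where T: "orthogonal_transformation T" "T (axis 1 1) = v0"
    using orthogonal_transformation_exists by blast
  have "G v0 = 0" using v0(1) by (simp add: G_def e_def dot_square_norm)
  then obtain Q where Q: "\<And>j. j < 4 \<Longrightarrow> form 2 (Q j)" "\<And>v. G (T v) = (\<Sum>j<(4::nat). (Q j v)\<^sup>2)"
    using nonneg_quartic_form_with_zero[OF form_compose[OF fG orthogonal_transformation_linear[OF T(1)]] G0] T(2)
    by auto
  define S where "S = inv T"
  have linS: "linear S" unfolding S_def
    by (intro orthogonal_transformation_linear orthogonal_transformation_inv T(1))
  have TS: "T (S v) = v" for v unfolding S_def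
    by (rule surj_f_inv_f[OF orthogonal_transformation_surj[OF T(1)]])
  define R where "R j v = (if j < 4 then Q j (S v) else sqrt e * (v \<bullet> v))" for j :: nat and v
  have "form 2 (R j)" for j
    by (cases "j < 4") (auto simp: R_def[abs_def] intro: form_compose[OF Q(1) linS] form_scale[OF N])
  moreover have "F v = (\<Sum>j<(5::nat). (R j v)\<^sup>2)" for v
  proof -
    have "(\<Sum>j<(5::nat). (R j v)\<^sup>2) = (\<Sum>j<(4::nat). (R j v)\<^sup>2) + (R 4 v)\<^sup>2"
      by (simp add: eval_nat_numeral)
    also have "(\<Sum>j<(4::nat). (R j v)\<^sup>2) = G v"
      using Q(2)[of "S v"] TS by (simp add: R_def)
    finally show ?thesis using e by (simp add: G_def R_def power_mult_distrib)
  qed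
  ultimately show ?thesis by blast
qed

section \<open>Points with two distinct coordinates\<close>

text \<open>Newton's identities: with \<open>e1\<close> and \<open>e2\<close> fixed, the third and
  fourth power sums are affine in \<open>x * y * z\<close> and the lower ones are constant. The
  clause on \<open>B\<close> serves to eliminate higher powers of the product in
  \<open>sym3_affine\<close>.\<close>

lemma power_sums3_affine:
  fixes e1 e2 :: real
  shows "\<exists>A B :: nat \<Rightarrow> real. (\<forall>k\<le>2. B k = 0) \<and> (\<forall>k\<le>4. \<forall>x y z. x + y + z = e1 \<longrightarrow> x * y + y * z + z * x = e2
    \<longrightarrow> x ^ k + y ^ k + z ^ k = A k + B k * (x * y * z))"
proof -
  define A where "A k = (if k = 0 then 3 else if k = 1 then e1 else if k = 2 then e1\<^sup>2 - 2 * e2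
    else if k = 3 then e1 ^ 3 - 3 * e1 * e2 else e1 ^ 4 - 4 * e1\<^sup>2 * e2 + 2 * e2\<^sup>2)" for k :: nat
  define B where "B k = (if k \<le> 2 then 0 else if k = 3 then 3 else 4 * e1)" for k :: nat
  have "x ^ k + y ^ k + z ^ k = A k + B k * (x * y * z)"
    if "k \<le> 4" and e: "x + y + z = e1" "x * y + y * z + z * x = e2" for k x y z
  proof -
    from \<open>k \<le> 4\<close> consider "k = 0" | "k = 1" | "k = 2" | "k = 3" | "k = 4" by linarith
    thus ?thesis
    proof cases
      case 3
      thus ?thesis unfolding A_def B_def e[symmetric] by (simp add: power2_eq_square algebra_simps)
    next
      case 4
      have "x ^ 3 + y ^ 3 + z ^ 3 = e1 ^ 3 - 3 * e1 * e2 + 3 * (x * y * z)" unfolding e[symmetric] by algebra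
      thus ?thesis using 4 by (simp add: A_def B_def)
    next
      case 5
      have "x ^ 4 + y ^ 4 + z ^ 4 = e1 ^ 4 - 4 * e1\<^sup>2 * e2 + 2 * e2\<^sup>2 + 4 * e1 * (x * y * z)"
        unfolding e[symmetric] by algebra
      thus ?thesis using 5 by (simp add: A_def B_def)
    qed (use e in \<open>auto simp: A_def B_def\<close>)
  qed
  moreover have "\<forall>k\<le>2. B k = 0" by (simp add: B_def)
  ultimately show ?thesis by blast
qed

text \<open>All six permutations are counted even when exponents coincide, so averaging over
  permutations involves no multiplicities.\<close>

definition sym3 :: "nat \<Rightarrow> nat \<Rightarrow> nat \<Rightarrow> real \<Rightarrow> real \<Rightarrow> real \<Rightarrow> real" where
  "sym3 a b c x y z = x^a * y^b * z^c + x^a * z^b * y^c + y^a * x^b * z^c + y^a * z^b * x^c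
     + z^a * x^b * y^c + z^a * y^b * x^c"

text \<open>In terms of power sums, every contribution of order two or more in the product contains
  some \<open>B j * B k\<close> with \<open>j + k \<le> 4\<close>. One of the two indices is then at
  most 2, so it vanishes.\<close>

lemma sym3_affine:
  assumes abc: "a + b + c \<le> 4"
  shows "\<exists>A B. \<forall>x y z. x + y + z = e1 \<longrightarrow> x * y + y * z + z * x = e2
    \<longrightarrow> sym3 a b c x y z = A + B * (x * y * z)"
proof -
  obtain A B :: "nat \<Rightarrow> real" where B0: "\<And>k. k \<le> 2 \<Longrightarrow> B k = 0" and
    P: "\<And>k x y z. k \<le> 4 \<Longrightarrow> x + y + z = e1 \<Longrightarrow> x * y + y * z + z * x = e2
      \<Longrightarrow> x ^ k + y ^ k + z ^ k = A k + B k * (x * y * z)"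
    using power_sums3_affine[of e1 e2] by blast
  have BB: "B j * B k = 0" if "j + k \<le> 4" for j k
    using B0[of j] B0[of k] that by fastforce
  let ?A = "A a * A b * A c - A (a + b) * A c - A (b + c) * A a - A (a + c) * A b + 2 * A (a + b + c)"
  let ?B = "B a * A b * A c + A a * B b * A c + A a * A b * B c
     - B (a + b) * A c - A (a + b) * B c - B (b + c) * A a - A (b + c) * B a
     - B (a + c) * A b - A (a + c) * B b + 2 * B (a + b + c)"
  have "sym3 a b c x y z = ?A + ?B * (x * y * z)"
    if e: "x + y + z = e1" "x * y + y * z + z * x = e2" for x y z
  proof -
    define p where "p k = x ^ k + y ^ k + z ^ k" for k
    define E where "E = x * y * z"
    have p: "p k = A k + B k * E" if "k \<le> 4" for k using P[OF that e] by (simp add: p_def E_def)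
    \<comment> \<open>Inclusion-exclusion over coincidences among the places of the three
      factors.\<close>
    have "sym3 a b c x y z = p a * p b * p c - p (a + b) * p c - p (b + c) * p a - p (a + c) * p b + 2 * p (a + b + c)"
      unfolding sym3_def p_def power_add by algebra
    also have "\<dots> = ?A + ?B * E + E\<^sup>2 * (B a * B b * A c + B a * B c * A b + B b * B c * A a
       - B (a + b) * B c - B (b + c) * B a - B (a + c) * B b) + E ^ 3 * (B a * B b * B c)"
    proof -
      have ps: "p a = A a + B a * E" "p b = A b + B b * E" "p c = A c + B c * E"
        "p (a + b) = A (a + b) + B (a + b) * E" "p (b + c) = A (b + c) + B (b + c) * E"
        "p (a + c) = A (a + c) + B (a + c) * E" "p (a + b + c) = A (a + b + c) + B (a + b + c) * E"
        using abc by (auto intro!: p)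
      show ?thesis unfolding ps by algebra
    qed
    also have "\<dots> = ?A + ?B * E"
    proof -
      have "B a * B b = 0" "B a * B c = 0" "B b * B c = 0" "B (a + b) * B c = 0"
        "B (b + c) * B a = 0" "B (a + c) * B b = 0"
        by (rule BB, use abc in linarith)+
      thus ?thesis by auto
    qed
    finally show ?thesis by (simp add: E_def)
  qed
  thus ?thesis by blast
qed

lemma symmetric_poly_eval:
  assumes "symmetric_poly n f" "\<pi> permutes {1..n}"
  shows "poly_eval (\<lambda>i. x (\<pi> i)) f = poly_eval x f"
  using assms poly_eval_subst[of x "\<lambda>i. Var (\<pi> i)" f]
  by (simp add: symmetric_poly_def poly_eval_Var)

text \<open>By symmetry \<open>f\<close> equals its average over the permutations of the three
  chosen coordinates. This average is a combination of \<open>sym3\<close> terms, with the other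
  coordinates absorbed into \<open>r m\<close>.\<close>

lemma symmetric_poly_affine:
  assumes f: "f \<in> polys n" and sym: "symmetric_poly n f"
    and deg: "\<And>m. m \<in> Poly_Mapping.keys f \<Longrightarrow> monom_degree m \<le> 4"
    and ijk: "i \<in> {1..n}" "j \<in> {1..n}" "k \<in> {1..n}" "i \<noteq> j" "j \<noteq> k" "i \<noteq> k"
  shows "\<exists>A B. \<forall>x y z. x + y + z = e1 \<longrightarrow> x * y + y * z + z * x = e2
    \<longrightarrow> poly_eval (X(i := x, j := y, k := z)) f = A + B * (x * y * z)"
proof -
  define g where "g x y z = poly_eval (X(i := x, j := y, k := z)) f" for x y z
  have s1: "g x y z = g x z y" for x y z
  proof -
    have "(\<lambda>l. (X(i := x, j := y, k := z)) (Transposition.transpose j k l)) = X(i := x, j := z, k := y)"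
      using ijk by (auto simp: Transposition.transpose_def fun_eq_iff)
    thus ?thesis unfolding g_def
      using symmetric_poly_eval[OF sym permutes_swap_id[OF ijk(2,3)], of "X(i := x, j := y, k := z)"] by simp
  qed
  have s2: "g x y z = g y x z" for x y z
  proof -
    have "(\<lambda>l. (X(i := x, j := y, k := z)) (Transposition.transpose i j l)) = X(i := y, j := x, k := z)"
      using ijk by (auto simp: Transposition.transpose_def fun_eq_iff)
    thus ?thesis unfolding g_def
      using symmetric_poly_eval[OF sym permutes_swap_id[OF ijk(1,2)], of "X(i := x, j := y, k := z)"] by simp
  qed
  define r where "r m = (\<Prod>l\<in>{1..n} - {i, j, k}. X l ^ Poly_Mapping.lookup m l)" for m
  have mon: "(\<Prod>l\<in>{1..n}. (X(i := x, j := y, k := z)) l ^ Poly_Mapping.lookup m l)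
      = r m * (x ^ Poly_Mapping.lookup m i * y ^ Poly_Mapping.lookup m j * z ^ Poly_Mapping.lookup m k)" for m x y z
  proof -
    let ?h = "\<lambda>l. (X(i := x, j := y, k := z)) l ^ Poly_Mapping.lookup m l"
    have "prod ?h {1..n} = prod ?h ({1..n} - {i, j, k}) * prod ?h {i, j, k}"
      using ijk by (intro prod.subset_diff) auto
    also have "prod ?h ({1..n} - {i, j, k}) = r m" unfolding r_def by (intro prod.cong) auto
    also have "prod ?h {i, j, k} = x ^ Poly_Mapping.lookup m i * y ^ Poly_Mapping.lookup m j * z ^ Poly_Mapping.lookup m k"
      using ijk by (simp add: mult.assoc)
    finally show ?thesis .
  qed
  have g: "g x y z = (\<Sum>m\<in>Poly_Mapping.keys f. Poly_Mapping.lookup f m * r m *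
     (x ^ Poly_Mapping.lookup m i * y ^ Poly_Mapping.lookup m j * z ^ Poly_Mapping.lookup m k))" for x y z
    unfolding g_def poly_eval_polys[OF f] mon by (simp add: mult.assoc)
  have g6: "6 * g x y z = (\<Sum>m\<in>Poly_Mapping.keys f. Poly_Mapping.lookup f m * r m *
     sym3 (Poly_Mapping.lookup m i) (Poly_Mapping.lookup m j) (Poly_Mapping.lookup m k) x y z)" for x y z
  proof -
    have "6 * g x y z = g x y z + g x z y + g y x z + g y z x + g z x y + g z y x"
      using s1[of x y z] s2[of x y z] s1[of y x z] s2[of z x y] s1[of z x y] by simp
    also have "\<dots> = (\<Sum>m\<in>Poly_Mapping.keys f. Poly_Mapping.lookup f m * r m *
     sym3 (Poly_Mapping.lookup m i) (Poly_Mapping.lookup m j) (Poly_Mapping.lookup m k) x y z)"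
      unfolding g sym3_def sum.distrib[symmetric] by (intro sum.cong refl) (simp add: algebra_simps)
    finally show ?thesis .
  qed
  have "\<exists>A B. \<forall>x y z. x + y + z = e1 \<longrightarrow> x * y + y * z + z * x = e2 \<longrightarrow>
     sym3 (Poly_Mapping.lookup m i) (Poly_Mapping.lookup m j) (Poly_Mapping.lookup m k) x y z = A + B * (x * y * z)"
    if "m \<in> Poly_Mapping.keys f" for m
  proof (rule sym3_affine)
    have "Poly_Mapping.lookup m i + Poly_Mapping.lookup m j + Poly_Mapping.lookup m k
       = (\<Sum>l\<in>{i, j, k}. Poly_Mapping.lookup m l)" using ijk by simp
    also have "\<dots> = (\<Sum>l\<in>{i, j, k} \<inter> Poly_Mapping.keys m. Poly_Mapping.lookup m l)"
      by (rule sum.mono_neutral_right) (auto simp: in_keys_iff)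
    also have "\<dots> \<le> monom_degree m" unfolding monom_degree_def by (rule sum_mono2) auto
    finally show "Poly_Mapping.lookup m i + Poly_Mapping.lookup m j + Poly_Mapping.lookup m k \<le> 4"
      using deg[OF that] by linarith
  qed
  then obtain A B where AB: "\<And>m x y z. m \<in> Poly_Mapping.keys f \<Longrightarrow> x + y + z = e1 \<Longrightarrow> x * y + y * z + z * x = e2 \<Longrightarrow>
     sym3 (Poly_Mapping.lookup m i) (Poly_Mapping.lookup m j) (Poly_Mapping.lookup m k) x y z = A m + B m * (x * y * z)"
    by metis
  have "g x y z = (\<Sum>m\<in>Poly_Mapping.keys f. Poly_Mapping.lookup f m * r m * A m) / 6
      + (\<Sum>m\<in>Poly_Mapping.keys f. Poly_Mapping.lookup f m * r m * B m) / 6 * (x * y * z)"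
    if e: "x + y + z = e1" "x * y + y * z + z * x = e2" for x y z
  proof -
    have "6 * g x y z = (\<Sum>m\<in>Poly_Mapping.keys f. Poly_Mapping.lookup f m * r m * (A m + B m * (x * y * z)))"
      unfolding g6 by (intro sum.cong refl) (simp only: AB[OF _ e])
    also have "\<dots> = (\<Sum>m\<in>Poly_Mapping.keys f. Poly_Mapping.lookup f m * r m * A m)
       + (\<Sum>m\<in>Poly_Mapping.keys f. Poly_Mapping.lookup f m * r m * B m) * (x * y * z)"
      unfolding sum_distrib_right sum.distrib[symmetric] by (intro sum.cong refl) (simp only: algebra_simps)
    finally show ?thesis by simp
  qed
  thus ?thesis unfolding g_def by blast
qed

text \<open>Move \<open>b\<close> to a nearby \<open>t\<close> and let the other two numbers be the
  roots of the quadratic that the constraints force. Its discriminant is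
  \<open>(a - c)^2 > 0\<close> at \<open>b\<close>, so the roots stay real, while the product has
  derivative \<open>(b - a) (b - c)\<close>, which is nonzero.\<close>

lemma vary_product_of_three:
  fixes a b c \<sigma> :: real
  assumes ne: "a \<noteq> b" "b \<noteq> c" "a \<noteq> c" and \<sigma>: "\<sigma> \<noteq> 0"
  obtains x y z where "x + y + z = a + b + c" "x * y + y * z + z * x = a * b + b * c + c * a"
    "\<sigma> * (x * y * z) < \<sigma> * (a * b * c)"
proof -
  define s q where "s = a + b + c" and "q = a * b + b * c + c * a"
  \<comment> \<open>The two other numbers have sum \<open>s - t\<close> and product
    \<open>q - t * (s - t)\<close>; \<open>disc\<close> is the discriminant of their
    quadratic.\<close>
  define h where "h t = \<sigma> * (t * (q - t * (s - t)))" for t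
  define disc where "disc t = (s - t)\<^sup>2 - 4 * (q - t * (s - t))" for t
  have hb: "h b = \<sigma> * (a * b * c)" by (simp add: h_def s_def q_def algebra_simps)
  have "disc b = (a - c)\<^sup>2" by (simp add: disc_def s_def q_def power2_eq_square algebra_simps)
  hence "disc b > 0" using ne by simp
  moreover have "isCont disc b" unfolding disc_def by (intro continuous_intros)
  ultimately have "\<forall>\<^sub>F t in at b. disc t > 0"
    by (intro order_tendstoD(1)[of disc "disc b"]) (auto simp: isCont_def)
  then obtain d where d: "d > 0" "\<And>t. t \<noteq> b \<Longrightarrow> dist t b < d \<Longrightarrow> disc t > 0"
    unfolding eventually_at by auto
  have "\<exists>t. \<bar>b - t\<bar> < d \<and> h t < h b"
  proof (rule ccontr)
    assume "\<not> ?thesis"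
    hence min: "\<forall>t. \<bar>b - t\<bar> < d \<longrightarrow> h b \<le> h t" by force
    have "DERIV h b :> \<sigma> * (q - 2 * b * s + 3 * b\<^sup>2)"
      unfolding h_def by (auto intro!: derivative_eq_intros simp: power2_eq_square algebra_simps)
    hence "\<sigma> * (q - 2 * b * s + 3 * b\<^sup>2) = 0" by (rule DERIV_local_min[OF _ d(1) min])
    moreover have "q - 2 * b * s + 3 * b\<^sup>2 = (b - a) * (b - c)" unfolding q_def s_def by algebra
    ultimately show False using ne \<sigma> by simp
  qed
  then obtain t where t: "\<bar>b - t\<bar> < d" "h t < h b" by blast
  hence "disc t > 0" using d(2)[of t] by (auto simp: dist_real_def abs_minus_commute)
  define x z where "x = ((s - t) + sqrt (disc t)) / 2" and "z = ((s - t) - sqrt (disc t)) / 2"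
  have xz: "x + z = s - t" by (simp add: x_def z_def field_simps)
  have "x * z = ((s - t)\<^sup>2 - (sqrt (disc t))\<^sup>2) / 4" by (simp add: x_def z_def power2_eq_square algebra_simps)
  also have "\<dots> = q - t * (s - t)" using \<open>disc t > 0\<close> by (simp add: disc_def)
  finally have xz': "x * z = q - t * (s - t)" .
  show ?thesis
  proof (rule that)
    show "x + t + z = a + b + c" using xz s_def by simp
    have "x * t + t * z + z * x = t * (x + z) + x * z" by (simp add: algebra_simps)
    thus "x * t + t * z + z * x = a * b + b * c + c * a" unfolding xz xz' q_def by simp
    have "h t = \<sigma> * (x * t * z)" unfolding h_def xz'[symmetric] by (simp add: mult_ac)
    thus "\<sigma> * (x * t * z) < \<sigma> * (a * b * c)" using t(2) hb by metis
  qed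
qed

section \<open>Minimisation with the first two power sums fixed\<close>

lemma compact_product_real:
  fixes S :: "nat \<Rightarrow> real set"
  assumes "\<And>i. compact (S i)"
  shows "compact {x. \<forall>i. x i \<in> S i}"
proof -
  have "{x. \<forall>i. x i \<in> S i} = PiE UNIV S" by (auto simp: PiE_def Pi_def)
  moreover have "compactin (product_topology (\<lambda>i. euclidean) UNIV) (PiE UNIV S)"
    unfolding compactin_PiE using assms by simp
  ultimately show ?thesis by (simp add: euclidean_product_topology)
qed

lemma continuous_on_coordinate: "continuous_on A (\<lambda>x :: nat \<Rightarrow> real. x i)"
  by (rule continuous_on_subset[OF continuous_on_product_coordinates]) simp

lemma continuous_on_poly_eval: "continuous_on A (\<lambda>x. poly_eval x f)"
  unfolding poly_eval_def by (intro continuous_intros continuous_on_coordinate)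

lemma sum_fun_upd3:
  fixes g :: "real \<Rightarrow> real" and X :: "nat \<Rightarrow> real"
  assumes "i \<in> I" "j \<in> I" "k \<in> I" "i \<noteq> j" "j \<noteq> k" "i \<noteq> k" "finite I"
  shows "(\<Sum>l\<in>I. g ((X(i := x, j := y, k := z)) l)) = (\<Sum>l\<in>I. g (X l)) - (g (X i) + g (X j) + g (X k)) + (g x + g y + g z)"
proof -
  have s: "(\<Sum>l\<in>I. h l) = (\<Sum>l\<in>I - {i, j, k}. h l) + (h i + h j + h k)" for h :: "nat \<Rightarrow> real"
  proof -
    have "sum h I = sum h (I - {i, j, k}) + sum h {i, j, k}"
      using assms by (intro sum.subset_diff) auto
    thus ?thesis using assms by simp
  qed
  have "(\<Sum>l\<in>I - {i, j, k}. g ((X(i := x, j := y, k := z)) l)) = (\<Sum>l\<in>I - {i, j, k}. g (X l))"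
    by (intro sum.cong) auto
  thus ?thesis unfolding s[of "\<lambda>l. g ((X(i := x, j := y, k := z)) l)"] s[of "\<lambda>l. g (X l)"]
    using assms by simp
qed

text \<open>Changing three coordinates without changing their first two elementary symmetric functions
  changes \<open>f\<close> affinely in their product, so at a minimiser of \<open>f\<close> with given first two power sums
  that also minimises the third one no three coordinates can be distinct.\<close>
lemma symmetric_quartic_two_valued_minorant:
  fixes x0 :: "nat \<Rightarrow> real"
  assumes f: "f \<in> polys n" and sym: "symmetric_poly n f"
    and deg: "\<And>m. m \<in> Poly_Mapping.keys f \<Longrightarrow> monom_degree m \<le> 4"
  obtains y u v where "poly_eval y f \<le> poly_eval x0 f" "\<And>i. i \<in> {1..n} \<Longrightarrow> y i = u \<or> y i = v"
proof -
  define c1 c2 where "c1 = (\<Sum>i\<in>{1..n}. x0 i)" and "c2 = (\<Sum>i\<in>{1..n}. (x0 i)\<^sup>2)"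
  \<comment> \<open>The second power sum bounds the coordinates in \<open>{1..n}\<close> and the
    others are pinned to 0, so Tychonoff's theorem applies in the space of functions.\<close>
  define S where "S i = (if i \<in> {1..n} then {- sqrt c2..sqrt c2} else {0})" for i
  define K where "K = {x. \<forall>i. x i \<in> S i} \<inter> {x. (\<Sum>i\<in>{1..n}. x i) = c1} \<inter> {x. (\<Sum>i\<in>{1..n}. (x i)\<^sup>2) = c2}"
  have "compact {x. \<forall>i. x i \<in> S i}" by (rule compact_product_real) (simp add: S_def)
  moreover have "closed {x. (\<Sum>i\<in>{1..n}. x i) = c1}" "closed {x. (\<Sum>i\<in>{1..n}. (x i)\<^sup>2) = c2}"
    by (intro closed_Collect_eq continuous_intros continuous_on_coordinate)+
  ultimately have K: "compact K" unfolding K_def by (intro compact_Int_closed)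
  have KI: "x \<in> K" if "\<And>i. i \<notin> {1..n} \<Longrightarrow> x i = 0" "(\<Sum>i\<in>{1..n}. x i) = c1" "(\<Sum>i\<in>{1..n}. (x i)\<^sup>2) = c2" for x
  proof -
    have "x i \<in> S i" for i
    proof (cases "i \<in> {1..n}")
      case True
      have "(x i)\<^sup>2 \<le> c2" unfolding that(3)[symmetric] by (rule member_le_sum) (use True in auto)
      hence "\<bar>x i\<bar> \<le> sqrt c2" by (simp add: real_le_rsqrt)
      thus ?thesis using True by (auto simp: S_def)
    next
      case False
      thus ?thesis using that(1) by (auto simp: S_def)
    qed
    thus ?thesis using that by (simp add: K_def)
  qed
  define x1 where "x1 i = (if i \<in> {1..n} then x0 i else 0)" for i
  have x1: "x1 \<in> K" by (rule KI) (auto simp: x1_def c1_def c2_def)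
  hence "K \<noteq> {}" by auto
  then obtain w where w: "w \<in> K" "\<And>x. x \<in> K \<Longrightarrow> poly_eval w f \<le> poly_eval x f"
    using continuous_attains_inf[OF K _ continuous_on_poly_eval] by blast
  \<comment> \<open>A second minimisation, of the sum of cubes among the minimisers of
    \<open>f\<close>, is the tie-breaker for the case that \<open>f\<close> does not change with the
    product.\<close>
  define K' where "K' = K \<inter> {x. poly_eval x f = poly_eval w f}"
  have "compact K'" unfolding K'_def
    by (intro compact_Int_closed[OF K] closed_Collect_eq continuous_on_poly_eval continuous_on_const)
  moreover have "K' \<noteq> {}" using w(1) by (auto simp: K'_def)
  moreover have "continuous_on K' (\<lambda>x. \<Sum>i\<in>{1..n}. (x i) ^ 3)"
    by (intro continuous_intros continuous_on_coordinate)
  ultimately obtain y where y: "y \<in> K'" "\<And>x. x \<in> K' \<Longrightarrow> (\<Sum>i\<in>{1..n}. (y i) ^ 3) \<le> (\<Sum>i\<in>{1..n}. (x i) ^ 3)"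
    using continuous_attains_inf[of K' "\<lambda>x. \<Sum>i\<in>{1..n}. (x i) ^ 3"] by blast
  have yK: "y \<in> K" and yw: "poly_eval y f = poly_eval w f" using y(1) by (auto simp: K'_def)
  have no3: False if ijk: "i \<in> {1..n}" "j \<in> {1..n}" "k \<in> {1..n}" and ne: "y i \<noteq> y j" "y j \<noteq> y k" "y i \<noteq> y k" for i j k
  proof -
    have ijk': "i \<noteq> j" "j \<noteq> k" "i \<noteq> k" using ne by auto
    define a b c where "a = y i" and "b = y j" and "c = y k"
    obtain A B where AB: "\<And>x' y' z'. x' + y' + z' = a + b + c \<Longrightarrow> x' * y' + y' * z' + z' * x' = a * b + b * c + c * a
        \<Longrightarrow> poly_eval (y(i := x', j := y', k := z')) f = A + B * (x' * y' * z')"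
      using symmetric_poly_affine[OF f sym deg ijk ijk'] by blast
    \<comment> \<open>With this sign, lowering \<open>\<sigma>\<close> times the product lowers
      \<open>f\<close> if \<open>B\<close> is nonzero, and lowers the product itself if
      \<open>B = 0\<close>.\<close>
    define \<sigma> :: real where "\<sigma> = (if B < 0 then - 1 else 1)"
    have ne': "a \<noteq> b" "b \<noteq> c" "a \<noteq> c" "\<sigma> \<noteq> 0" using ne by (auto simp: a_def b_def c_def \<sigma>_def)
    obtain a' b' c' where e: "a' + b' + c' = a + b + c" "a' * b' + b' * c' + c' * a' = a * b + b * c + c * a"
      and lt: "\<sigma> * (a' * b' * c') < \<sigma> * (a * b * c)"
      by (rule vary_product_of_three[OF ne'])
    define z where "z = y(i := a', j := b', k := c')"
    have up: "(\<Sum>l\<in>{1..n}. g (z l)) = (\<Sum>l\<in>{1..n}. g (y l)) - (g a + g b + g c) + (g a' + g b' + g c')" for g :: "real \<Rightarrow> real"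
      unfolding z_def a_def b_def c_def using sum_fun_upd3[OF ijk ijk'] by simp
    have "z \<in> K"
    proof (rule KI)
      show "z l = 0" if "l \<notin> {1..n}" for l
      proof -
        have "y l \<in> S l" using yK by (simp add: K_def)
        hence "y l = 0" using that by (simp add: S_def split: if_splits)
        thus ?thesis using that ijk by (auto simp: z_def)
      qed
      show "(\<Sum>l\<in>{1..n}. z l) = c1" using up[of "\<lambda>t. t"] e(1) yK by (simp add: K_def)
      have "a'\<^sup>2 + b'\<^sup>2 + c'\<^sup>2 = (a' + b' + c')\<^sup>2 - 2 * (a' * b' + b' * c' + c' * a')" by algebra
      also have "\<dots> = a\<^sup>2 + b\<^sup>2 + c\<^sup>2" unfolding e by algebra
      finally show "(\<Sum>l\<in>{1..n}. (z l)\<^sup>2) = c2" using up[of "\<lambda>t. t\<^sup>2"] yK by (simp add: K_def)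
    qed
    have fz: "poly_eval z f = A + B * (a' * b' * c')" unfolding z_def using AB[OF e] .
    have fy: "poly_eval y f = A + B * (a * b * c)"
      using AB[of a b c] by (simp add: a_def b_def c_def)
    have "poly_eval y f \<le> poly_eval z f" using w(2)[OF \<open>z \<in> K\<close>] yw by simp
    hence le: "B * (a * b * c) \<le> B * (a' * b' * c')" using fz fy by simp
    have B0: "B = 0"
    proof (rule ccontr)
      assume "B \<noteq> 0"
      hence "B * (a' * b' * c') < B * (a * b * c)"
        using lt by (cases "B < 0") (auto simp: \<sigma>_def mult_less_cancel_left)
      thus False using le by simp
    qed
    hence "z \<in> K'" using \<open>z \<in> K\<close> fz fy yw by (simp add: K'_def)
    \<comment> \<open>With the first two elementary symmetric functions fixed, the sum of cubes
      changes by three times the change of the product.\<close>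
    have "a' ^ 3 + b' ^ 3 + c' ^ 3 = (a' + b' + c') ^ 3 - 3 * (a' + b' + c') * (a' * b' + b' * c' + c' * a') + 3 * (a' * b' * c')"
      by algebra
    also have "\<dots> = a ^ 3 + b ^ 3 + c ^ 3 - 3 * (a * b * c) + 3 * (a' * b' * c')" unfolding e by algebra
    also have "\<dots> < a ^ 3 + b ^ 3 + c ^ 3" using lt B0 by (simp add: \<sigma>_def)
    finally show False using y(2)[OF \<open>z \<in> K'\<close>] up[of "\<lambda>t. t ^ 3"] by simp
  qed
  have "\<exists>u v. \<forall>i\<in>{1..n}. y i = u \<or> y i = v"
  proof (cases "\<exists>i\<in>{1..n}. \<exists>j\<in>{1..n}. y i \<noteq> y j")
    case True
    then obtain i j where "i \<in> {1..n}" "j \<in> {1..n}" "y i \<noteq> y j" by blast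
    thus ?thesis using no3 by (intro exI[of _ "y i"] exI[of _ "y j"]) metis
  next
    case False
    thus ?thesis by (metis (no_types))
  qed
  then obtain u v where "\<And>i. i \<in> {1..n} \<Longrightarrow> y i = u \<or> y i = v" by blast
  moreover have "poly_eval y f \<le> poly_eval x0 f"
  proof -
    have "poly_eval x1 f = poly_eval x0 f" by (rule poly_eval_cong[OF f]) (simp add: x1_def)
    thus ?thesis using w(2)[OF x1] yw by simp
  qed
  ultimately show ?thesis using that by blast
qed

section \<open>Partition polynomials\<close>

text \<open>Dehomogenisation: this leads from forms as functions back to formal polynomials in two
  variables.\<close>

lemma form_poly_eval:
  assumes "form k F"
  shows "\<exists>g\<in>polys 2. \<forall>x. poly_eval x g = F (vector [x 1, x 2, 1])"
  using assms
proof (induction rule: form.induct)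
  case (form_const c)
  show ?case by (intro bexI[of _ "Const c"]) (auto simp: poly_eval_Const polys_Const)
next
  case (form_linear_mult l k F)
  then obtain g where g: "g \<in> polys 2" "\<And>x. poly_eval x g = F (vector [x 1, x 2, 1])" by blast
  let ?l = "Const (l (axis 1 1)) * Var 1 + Const (l (axis 2 1)) * Var 2 + Const (l (axis 3 1))"
  have "?l * g \<in> polys 2"
    by (intro polys_mult polys_add polys_Const polys_Var g) auto
  moreover have "poly_eval x (?l * g) = l (vector [x 1, x 2, 1]) * F (vector [x 1, x 2, 1])" for x
    by (simp add: poly_eval_add poly_eval_mult poly_eval_Const poly_eval_Var g
          linear_vector_3[OF form_linear_mult.hyps(1)])
  ultimately show ?case by blast
next
  case (form_add k F G)
  then obtain f g where "f \<in> polys 2" "\<And>x. poly_eval x f = F (vector [x 1, x 2, 1])"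
    "g \<in> polys 2" "\<And>x. poly_eval x g = G (vector [x 1, x 2, 1])" by blast
  thus ?case by (intro bexI[of _ "f + g"]) (auto simp: poly_eval_add polys_add)
qed

lemma partition_poly_polys: "partition_poly \<omega> f \<in> polys 2"
  unfolding partition_poly_def by (intro polys_subst) (auto intro: polys_Var)

lemma poly_eval_partition_poly:
  "poly_eval x (partition_poly \<omega> f) = poly_eval (\<lambda>i. if i \<le> fst \<omega> then x 1 else x 2) f"
proof -
  have "(\<lambda>i. poly_eval x (if i \<le> fst \<omega> then Var 1 else Var 2)) = (\<lambda>i. if i \<le> fst \<omega> then x 1 else x 2)"
    by (auto simp: poly_eval_Var)
  thus ?thesis by (simp add: partition_poly_def poly_eval_subst)
qed

lemma nonneg_partition_poly_sum_of_squares: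
  assumes nn: "nonneg_poly f" and deg: "\<And>m. m \<in> Poly_Mapping.keys f \<Longrightarrow> monom_degree m \<le> 4"
  shows "sum_of_squares 2 (partition_poly \<omega> f)"
proof -
  define y where "y v i = (if i \<le> fst \<omega> then v $ 1 else v $ 2)" for v :: "real^3" and i :: nat
  \<comment> \<open>The homogenisation of the partition polynomial by the third coordinate. The
    degree bound makes the subtraction of naturals exact, so every term has degree 4.\<close>
  define F where "F v = (\<Sum>m\<in>Poly_Mapping.keys f. Poly_Mapping.lookup f m *
     ((v $ 3) ^ (4 - monom_degree m) * (\<Prod>i\<in>Poly_Mapping.keys m. y v i ^ Poly_Mapping.lookup m i)))"
    for v :: "real^3"
  have liny: "form 1 (\<lambda>v. y v i)" for i
    using form_linear[OF linear_nth] by (cases "i \<le> fst \<omega>") (auto simp: y_def)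
  have F: "form 4 F" unfolding F_def
  proof (intro form_sum form_scale)
    fix m assume "m \<in> Poly_Mapping.keys f"
    hence d: "monom_degree m \<le> 4" by (rule deg)
    have "form (1 * (4 - monom_degree m) + (\<Sum>i\<in>Poly_Mapping.keys m. 1 * Poly_Mapping.lookup m i))
       (\<lambda>v. (v $ 3) ^ (4 - monom_degree m) * (\<Prod>i\<in>Poly_Mapping.keys m. y v i ^ Poly_Mapping.lookup m i))"
      by (intro form_mult form_power form_prod liny form_linear linear_nth)
    moreover have "1 * (4 - monom_degree m) + (\<Sum>i\<in>Poly_Mapping.keys m. 1 * Poly_Mapping.lookup m i) = 4"
      using d by (simp add: monom_degree_def)
    ultimately show "form 4 (\<lambda>v. (v $ 3) ^ (4 - monom_degree m) *
       (\<Prod>i\<in>Poly_Mapping.keys m. y v i ^ Poly_Mapping.lookup m i))" by simp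
  qed
  have F1: "F (vector [x 1, x 2, 1]) = poly_eval x (partition_poly \<omega> f)" for x
  proof -
    have "y (vector [x 1, x 2, 1]) = (\<lambda>i. if i \<le> fst \<omega> then x 1 else x 2)"
      by (auto simp: y_def)
    thus ?thesis by (simp add: F_def poly_eval_partition_poly poly_eval_def[of _ f])
  qed
  have F1nn: "F (vector [a, b, 1]) \<ge> 0" for a b
  proof -
    have "F (vector [a, b, 1]) = poly_eval (\<lambda>i. if i \<le> fst \<omega> then a else b) f"
      using F1[of "\<lambda>i. if i = 1 then a else b"] by (simp add: poly_eval_partition_poly)
    thus ?thesis using nn by (simp add: nonneg_poly_def)
  qed
  have "F v \<ge> 0" for v by (rule form_nonneg[OF F F1nn]) simp
  then obtain Q where Q: "\<And>j. j < 5 \<Longrightarrow> form 2 (Q j)" "\<And>v. F v = (\<Sum>j<(5::nat). (Q j v)\<^sup>2)"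
    using nonneg_ternary_quartic_form[OF F] by blast
  have "\<exists>g. \<forall>j<5. g j \<in> polys 2 \<and> (\<forall>x. poly_eval x (g j) = Q j (vector [x 1, x 2, 1]))"
    using form_poly_eval[OF Q(1)] by metis
  then obtain g where g: "\<And>j. j < 5 \<Longrightarrow> g j \<in> polys 2"
    "\<And>j x. j < 5 \<Longrightarrow> poly_eval x (g j) = Q j (vector [x 1, x 2, 1])" by blast
  have "partition_poly \<omega> f = (\<Sum>j<5. (g j)\<^sup>2)"
  proof (rule polys2_eqI)
    show "(\<Sum>j<5. (g j)\<^sup>2) \<in> polys 2" by (intro polys_sum polys_power g(1)) simp
    show "poly_eval x (partition_poly \<omega> f) = poly_eval x (\<Sum>j<5. (g j)\<^sup>2)" for x
      unfolding F1[symmetric] Q(2) poly_eval_sum poly_eval_power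
      by (intro sum.cong refl) (simp add: g(2))
  qed (rule partition_poly_polys)
  thus ?thesis unfolding sum_of_squares_def using g(1) by blast
qed

text \<open>The larger of the two level sets serves as \<open>U\<close>, since the first part of a
  2-partition is the larger one.\<close>

lemma two_valued_partition:
  fixes y :: "nat \<Rightarrow> 'a"
  assumes n: "n \<ge> 2" and y: "\<And>i. i \<in> {1..n} \<Longrightarrow> y i = u \<or> y i = v"
  obtains U u' v' where "U \<subseteq> {1..n}" "0 < card ({1..n} - U)" "card ({1..n} - U) \<le> card U"
    "\<And>i. i \<in> {1..n} \<Longrightarrow> y i = (if i \<in> U then u' else v')"
proof -
  define A where "A = {i \<in> {1..n}. y i = u}"
  define B where "B = {1..n} - A"
  have A: "A \<subseteq> {1..n}" by (auto simp: A_def)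
  have B: "B \<subseteq> {1..n}" "{1..n} - B = A" using A by (auto simp: B_def)
  have fin: "finite A" "finite B" using A B finite_subset[of _ "{1..n}"] by auto
  have yA: "y i = (if i \<in> A then u else v)" and yB: "y i = (if i \<in> B then v else u)" if "i \<in> {1..n}" for i
    using y[OF that] that by (auto simp: A_def B_def)
  note witness = that
  \<comment> \<open>Both parts must be nonempty even for constant \<open>y\<close>; then the index
    \<open>n\<close> is split off, which is possible because \<open>n \<ge> 2\<close>.\<close>
  have const: thesis if w: "\<And>i. i \<in> {1..n} \<Longrightarrow> y i = w" for w
  proof (rule witness)
    have "{1..n} - {1..n - 1} = {n}" using n by auto
    thus "0 < card ({1..n} - {1..n - 1})" "card ({1..n} - {1..n - 1}) \<le> card {1..n - 1}" using n by auto
    show "y i = (if i \<in> {1..n - 1} then w else w)" if "i \<in> {1..n}" for i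
      using w[OF that] by simp
  qed auto
  consider "A = {}" | "B = {}" | "A \<noteq> {}" "B \<noteq> {}" "card B \<le> card A" | "A \<noteq> {}" "B \<noteq> {}" "card A \<le> card B"
    by linarith
  thus ?thesis
  proof cases
    case 1
    thus ?thesis using yA by (intro const[of v]) auto
  next
    case 2
    thus ?thesis using yB by (intro const[of u]) auto
  next
    case 3
    show ?thesis
      by (rule witness[OF A _ _ yA, folded B_def]) (use 3 fin in \<open>simp_all add: card_gt_0_iff\<close>)
  next
    case 4
    show ?thesis
      by (rule witness[OF B(1) _ _ yB, unfolded B(2)]) (use 4 fin in \<open>simp_all add: card_gt_0_iff\<close>)
  qed
qed

text \<open>\<open>partition_poly\<close> substitutes the first variable on an initial segment of
  indices, so \<open>U\<close> has to be moved there. The permutation is glued from bijections onto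
  \<open>U\<close> and onto its complement.\<close>

lemma permutes_initial_segment:
  assumes U: "U \<subseteq> {1..n}"
  obtains \<pi> where "\<pi> permutes {1..n}" "\<And>i. i \<in> {1..n} \<Longrightarrow> \<pi> i \<in> U \<longleftrightarrow> i \<le> card U"
proof -
  let ?k = "card U"
  have fin: "finite U" using U finite_subset by blast
  have k: "?k \<le> n" using card_mono[OF _ U] by simp
  obtain h where h: "bij_betw h {1..?k} U"
    using finite_same_card_bij[of "{1..?k}" U] fin by auto
  have "card ({1..n} - U) = n - ?k" using U by (simp add: card_Diff_subset fin)
  then obtain h' where h': "bij_betw h' {?k + 1..n} ({1..n} - U)"
    using finite_same_card_bij[of "{?k + 1..n}" "{1..n} - U"] by auto
  define \<pi> where "\<pi> i = (if i \<in> {1..?k} then h i else if i \<in> {?k + 1..n} then h' i else i)" for i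
  have b1: "bij_betw \<pi> {1..?k} U" using h by (rule bij_betw_cong[THEN iffD1, rotated]) (simp add: \<pi>_def)
  have b2: "bij_betw \<pi> {?k + 1..n} ({1..n} - U)"
    using h' by (rule bij_betw_cong[THEN iffD1, rotated]) (simp add: \<pi>_def)
  have "bij_betw \<pi> ({1..?k} \<union> {?k + 1..n}) (U \<union> ({1..n} - U))"
    by (rule bij_betw_combine[OF b1 b2]) auto
  moreover have "{1..?k} \<union> {?k + 1..n} = {1..n}" "U \<union> ({1..n} - U) = {1..n}" using k U by auto
  ultimately have "bij_betw \<pi> {1..n} {1..n}" by simp
  hence "\<pi> permutes {1..n}" by (rule bij_imp_permutes) (use k in \<open>auto simp: \<pi>_def\<close>)
  moreover have "\<pi> i \<in> U \<longleftrightarrow> i \<le> ?k" if "i \<in> {1..n}" for i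
  proof (cases "i \<le> ?k")
    case True
    thus ?thesis using bij_betwE[OF b1] that by auto
  next
    case False
    thus ?thesis using bij_betwE[OF b2] that by auto
  qed
  ultimately show ?thesis using that by blast
qed

lemma sum_of_squares_nonneg:
  assumes "sum_of_squares k p"
  shows "poly_eval x p \<ge> 0"
proof -
  obtain r :: nat and g where "p = (\<Sum>j<r. (g j)\<^sup>2)"
    using assms unfolding sum_of_squares_def by blast
  thus ?thesis by (simp add: poly_eval_sum poly_eval_power sum_nonneg)
qed

lemma two_valued_eval_nonneg:
  assumes n: "n \<ge> 2" and f: "f \<in> polys n" and sym: "symmetric_poly n f"
    and sos: "\<forall>\<omega> \<in> two_partitions n. sum_of_squares 2 (partition_poly \<omega> f)"
    and y: "\<And>i. i \<in> {1..n} \<Longrightarrow> y i = u \<or> y i = v"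
  shows "poly_eval y f \<ge> 0"
proof -
  obtain U a b where U: "U \<subseteq> {1..n}" "0 < card ({1..n} - U)" "card ({1..n} - U) \<le> card U"
    and yU: "\<And>i. i \<in> {1..n} \<Longrightarrow> y i = (if i \<in> U then a else b)"
    using two_valued_partition[OF n, of y u v] y by blast
  obtain \<pi> where \<pi>: "\<pi> permutes {1..n}" "\<And>i. i \<in> {1..n} \<Longrightarrow> \<pi> i \<in> U \<longleftrightarrow> i \<le> card U"
    using permutes_initial_segment[OF U(1)] by blast
  define \<omega> where "\<omega> = (card U, card ({1..n} - U))"
  have "card U \<le> n" using card_mono[OF _ U(1)] by simp
  moreover have "card ({1..n} - U) = n - card U"
    using U(1) finite_subset[OF U(1)] by (simp add: card_Diff_subset)
  ultimately have "\<omega> \<in> two_partitions n" using U by (simp add: \<omega>_def two_partitions_def)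
  \<comment> \<open>With \<open>a\<close> for the first variable and \<open>b\<close> for the
    second, the partition polynomial takes the value of \<open>f\<close> at the rearrangement of
    \<open>y\<close> by \<open>\<pi>\<close>.\<close>
  hence "poly_eval (\<lambda>i. if i = 1 then a else b) (partition_poly \<omega> f) \<ge> 0"
    using sos sum_of_squares_nonneg by blast
  also have "poly_eval (\<lambda>i. if i = 1 then a else b) (partition_poly \<omega> f)
     = poly_eval (\<lambda>i. if i \<le> card U then a else b) f"
    by (simp add: poly_eval_partition_poly \<omega>_def)
  also have "\<dots> = poly_eval (\<lambda>i. y (\<pi> i)) f"
    by (rule poly_eval_cong[OF f]) (simp only: yU \<pi>(2) permutes_in_image[OF \<pi>(1)])
  also have "\<dots> = poly_eval y f" by (rule symmetric_poly_eval[OF sym \<pi>(1)])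
  finally show ?thesis .
qed

theorem theorem5p5:
  fixes n :: nat and f :: real_mpoly
  assumes "n \<ge> 2"
    and "f \<in> polys n"
    and "symmetric_poly n f"
    and "total_degree f = 4"
  shows "nonneg_poly f \<longleftrightarrow>
    (\<forall>\<omega> \<in> two_partitions n. sum_of_squares 2 (partition_poly \<omega> f))"
proof -
  have deg: "monom_degree m \<le> 4" if "m \<in> Poly_Mapping.keys f" for m
    unfolding assms(4)[symmetric] total_degree_def using that by (intro Max_ge) auto
  show ?thesis
  proof
    assume "nonneg_poly f"
    thus "\<forall>\<omega> \<in> two_partitions n. sum_of_squares 2 (partition_poly \<omega> f)"
      using nonneg_partition_poly_sum_of_squares deg by blast
  next
    assume sos: "\<forall>\<omega> \<in> two_partitions n. sum_of_squares 2 (partition_poly \<omega> f)"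
    show "nonneg_poly f" unfolding nonneg_poly_def
    proof
      fix x
      obtain y u v where "poly_eval y f \<le> poly_eval x f" "\<And>i. i \<in> {1..n} \<Longrightarrow> y i = u \<or> y i = v"
        using symmetric_quartic_two_valued_minorant[OF assms(2,3) deg] by blast
      thus "0 \<le> poly_eval x f"
        using two_valued_eval_nonneg[OF assms(1-3) sos] by (meson order_trans)
    qed
  qed
qed

end
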